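(* Let $q$ be even with $q \ge 8$. Then $m'_2(3,q) \le q^2 - q + 3$.
   Context: A $k$-cap of the projective space $\mathrm{PG}(n,q)$, $n \ge 3$, is a set of $k$ points no three of which are collinear. A $k$-cap is complete if it is not contained in a $(k+1)$-cap. $m'_2(n,q)$ denotes the second largest value of $k$ for which there exists a complete $k$-cap in $\mathrm{PG}(n,q)$ (i.e. the largest size of a complete cap that is not of maximum size; for $q$ even, $q>2$, the maximum size of a cap in $\mathrm{PG}(3,q)$ is $q^2+1$). *)

theory Defs
  imports "HOL-Analysis.Analysis"
begin

text \<open>
  The projective space \<open>PG(n,q)\<close> is the lattice of subspaces of the vector space \<open>'a ^ 'n\<close>, where
  \<open>'a\<close> is the finite field with \<open>q = CARD('a)\<close> elements and \<open>CARD('n) = n + 1\<close>: points and lines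
  are the subspaces of vector space dimension 1 and 2, and incidence is inclusion.
\<close>

definition pg_points :: "('a::field ^ 'n::finite) set set" where
  "pg_points = {U. vec.subspace U \<and> vec.dim U = 1}"

definition pg_lines :: "('a::field ^ 'n::finite) set set" where
  "pg_lines = {U. vec.subspace U \<and> vec.dim U = 2}"

definition pg_collinear :: "('a::field ^ 'n::finite) set set \<Rightarrow> bool" where
  "pg_collinear S \<longleftrightarrow> (\<exists>L\<in>pg_lines. \<forall>P\<in>S. P \<subseteq> L)"

definition cap :: "nat \<Rightarrow> ('a::{field,finite} ^ 'n::finite) set set \<Rightarrow> bool" where
  "cap k K \<longleftrightarrow> K \<subseteq> pg_points \<and> card K = k \<and>
     (\<forall>P\<in>K. \<forall>Q\<in>K. \<forall>R\<in>K. P \<noteq> Q \<and> P \<noteq> R \<and> Q \<noteq> R \<longrightarrow> \<not> pg_collinear {P, Q, R})"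

definition complete_cap :: "nat \<Rightarrow> ('a::{field,finite} ^ 'n::finite) set set \<Rightarrow> bool" where
  "complete_cap k K \<longleftrightarrow> cap k K \<and> \<not> (\<exists>K'. K \<subseteq> K' \<and> cap (k + 1) K')"

definition complete_cap_sizes :: "('a::{field,finite} ^ 'n::finite) itself \<Rightarrow> nat set" where
  "complete_cap_sizes _ = {k. \<exists>K :: ('a ^ 'n) set set. complete_cap k K}"

text \<open>
  The set of sizes is finite, so on it \<^const>\<open>Sup\<close> is the maximum; should all complete caps have
  the same size, the second largest size is 0 by convention.
\<close>

definition m2' :: "('a::{field,finite} ^ 'n::finite) itself \<Rightarrow> nat" where
  "m2' T = Sup (complete_cap_sizes T - {Sup (complete_cap_sizes T)})"

lemma finite_complete_cap_sizes:
  "finite (complete_cap_sizes (T :: ('a::{field,finite} ^ 'n::finite) itself))"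
proof -
  have "complete_cap_sizes T \<subseteq> card ` (UNIV :: ('a ^ 'n) set set set)"
    by (auto simp: complete_cap_sizes_def complete_cap_def cap_def)
  then show ?thesis
    by (rule finite_subset) simp
qed

lemma m2'_eq_Max:
  fixes T :: "('a::{field,finite} ^ 'n::finite) itself"
  assumes "complete_cap_sizes T - {Max (complete_cap_sizes T)} \<noteq> {}"
  shows "m2' T = Max (complete_cap_sizes T - {Max (complete_cap_sizes T)})"
proof -
  have ne: "complete_cap_sizes T \<noteq> {}"
    using assms by auto
  have "Sup (complete_cap_sizes T) = Max (complete_cap_sizes T)"
    using finite_complete_cap_sizes ne by (rule cSup_eq_Max)
  then show ?thesis
    using assms finite_complete_cap_sizes[of T] by (simp add: m2'_def cSup_eq_Max)
qed

end

theory Submission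
  imports Defs "HOL-Computational_Algebra.Polynomial"
begin

text \<open>
  Let \<open>K\<close> be a complete \<open>k\<close>-cap, and \<open>t = q\<^sup>2 + q + 2 - k\<close> the number of tangents at each of its
  points.  In a plane with \<open>n\<close> points of \<open>K\<close> there are \<open>d = q + 2 - n\<close> tangents at each of these
  points, and in even characteristic a point \<open>N\<close> on a secant lies on at most \<open>d\<close> of them (Segre).
  Every \<open>N\<close> off \<open>K\<close> lies on a secant because \<open>K\<close> is complete; summing over the planes through it
  shows that \<open>N\<close> lies on at most \<open>t\<close> tangents.  Counting the tangents that meet a fixed tangent
  \<open>l\<close> then gives \<open>\<Sum> (d - 1)\<^sup>2 \<ge> k - 1\<close> over the planes through \<open>l\<close>, while \<open>\<Sum> (d - 1) = t - 1\<close>.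
  If \<open>q + 1 < t \<le> 2 q - 2\<close>, every tangent at a point \<open>P\<close> thus lies in a plane with at least
  \<open>q / 2 + 2\<close> tangents at \<open>P\<close>.  There are at most three such planes, so the inequality forces
  \<open>d \<ge> q\<close> in each of them; but two of them already carry \<open>2 q - 1\<close> tangents.  The same
  inequality excludes \<open>0 < t \<le> q\<close>, and for \<open>t = 0\<close> every plane would meet \<open>K\<close> in \<open>0\<close> or \<open>q + 2\<close>
  points, which is impossible for the planes through an external line.
  Hence \<open>k \<le> q\<^sup>2 - q + 3\<close> or \<open>k = q\<^sup>2 + 1\<close>.
\<close>

section \<open>Tangents of plane arcs in characteristic 2\<close>

text \<open>The left side is the coefficient of degree \<open>card Y - 1\<close> in the Lagrange
  interpolation polynomial of \<open>g\<close> at the nodes \<open>Y\<close>. Since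
  \<open>degree g < card Y\<close>, that polynomial is \<open>g\<close> itself.\<close>

lemma lagrange_leading_coeff:
  fixes g :: "'a::field poly"
  assumes "finite Y" and "degree g < card Y"
  shows "(\<Sum>b\<in>Y. poly g b / (\<Prod>u\<in>Y - {b}. b - u)) = coeff g (card Y - 1)"
proof -
  \<comment> \<open>The basis polynomials stay unnormalised, hence monic; their values at the nodes
    are divided out in the weights \<open>w b\<close>.\<close>
  define l where "l b = (\<Prod>u\<in>Y - {b}. [:- u, 1:])" for b
  define w where "w b = poly g b / (\<Prod>u\<in>Y - {b}. b - u)" for b
  define p where "p = (\<Sum>b\<in>Y. smult (w b) (l b))"
  have deg_l: "degree (l b) = card Y - 1" if "b \<in> Y" for b
    unfolding l_def using that assms(1) by (subst degree_prod_eq_sum_degree) auto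
  have lead_l: "coeff (l b) (card Y - 1) = 1" if "b \<in> Y" for b
  proof -
    have "lead_coeff (l b) = 1"
      unfolding l_def by (subst lead_coeff_prod) simp
    then show ?thesis using deg_l[OF that] by simp
  qed
  have poly_l: "poly (l b) c = (if b = c then (\<Prod>u\<in>Y - {b}. b - u) else 0)" if "c \<in> Y" for b c
    using that assms(1) by (auto simp: l_def poly_prod)
  have nz: "(\<Prod>u\<in>Y - {b}. b - u) \<noteq> 0" for b
    using assms(1) by simp
  have "poly (g - p) c = 0" if "c \<in> Y" for c
    using that assms(1) nz by (simp add: p_def poly_sum poly_l w_def if_distrib cong: if_cong)
  moreover have "degree (g - p) < card Y"
  proof -
    have "degree p \<le> card Y - 1"
      unfolding p_def by (rule degree_sum_le) (use assms deg_l in \<open>auto intro: order.trans[OF degree_smult_le]\<close>)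
    then show ?thesis
      using assms(2) by (intro degree_diff_less) auto
  qed
  ultimately have "g - p = 0"
  proof (rule_tac ccontr)
    assume roots: "\<And>c. c \<in> Y \<Longrightarrow> poly (g - p) c = 0" and "degree (g - p) < card Y"
      and "g - p \<noteq> 0"
    then have "card {x. poly (g - p) x = 0} < card Y"
      using card_poly_roots_bound[of "g - p"] by simp
    moreover have "card Y \<le> card {x. poly (g - p) x = 0}"
      using roots \<open>g - p \<noteq> 0\<close> by (intro card_mono poly_roots_finite) auto
    ultimately show False by simp
  qed
  then have "coeff g (card Y - 1) = (\<Sum>b\<in>Y. w b)"
    by (simp add: p_def coeff_sum lead_l del: One_nat_def)
  then show ?thesis by (simp add: w_def)
qed

text \<open>Up to a constant, the reciprocals of the products over \<open>S\<close> are values of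
  the monic polynomial \<open>g\<close> whose roots are the elements outside \<open>S\<close>.
  Interpolating \<open>g\<close> at \<open>Y\<close> turns the sum into a coefficient of
  \<open>g\<close>, which is either beyond its degree or the leading one.\<close>

lemma finite_field_reciprocal_sum:
  fixes Y S :: "'a::{field,finite} set"
  assumes "Y \<subseteq> S" and "CARD('a) < card S + card Y"
  shows "(\<Sum>b\<in>Y. 1 / ((\<Prod>u\<in>Y - {b}. b - u) * (\<Prod>c\<in>S - {b}. b - c))) = 0 \<longleftrightarrow>
    CARD('a) + 1 < card S + card Y"
proof -
  define g :: "'a poly" where "g = (\<Prod>m\<in>- S. [:- m, 1:])"
  define \<kappa> :: 'a where "\<kappa> = (\<Prod>z\<in>UNIV - {0}. z)"
  have \<kappa>: "\<kappa> \<noteq> 0" by (simp add: \<kappa>_def)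
  have card_S: "card (- S) + card S = CARD('a)"
    by (simp add: Compl_eq_Diff_UNIV card_Diff_subset card_mono)
  have deg: "degree g = card (- S)"
    unfolding g_def by (subst degree_prod_eq_sum_degree) auto
  have lead: "lead_coeff g = 1"
    unfolding g_def by (subst lead_coeff_prod) simp
  have val: "poly g b = \<kappa> / (\<Prod>c\<in>S - {b}. b - c)" if "b \<in> Y" for b
  proof -
    \<comment> \<open>The two products together run over all nonzero field elements.\<close>
    have "(\<Prod>c\<in>S - {b}. b - c) * poly g b = (\<Prod>m\<in>UNIV - {b}. b - m)"
    proof -
      have "UNIV - {b} = (S - {b}) \<union> - S" using that assms(1) by auto
      moreover have "(\<Prod>m\<in>(S - {b}) \<union> - S. b - m) = (\<Prod>m\<in>S - {b}. b - m) * (\<Prod>m\<in>- S. b - m)"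
        by (rule prod.union_disjoint) auto
      ultimately show ?thesis by (simp add: g_def poly_prod)
    qed
    also have "\<dots> = \<kappa>"
      unfolding \<kappa>_def
      by (rule prod.reindex_bij_witness[of _ "\<lambda>z. b - z" "\<lambda>m. b - m"]) auto
    finally show ?thesis by (simp add: field_simps)
  qed
  have "\<kappa> * (\<Sum>b\<in>Y. 1 / ((\<Prod>u\<in>Y - {b}. b - u) * (\<Prod>c\<in>S - {b}. b - c)))
      = (\<Sum>b\<in>Y. poly g b / (\<Prod>u\<in>Y - {b}. b - u))"
    by (simp add: sum_distrib_left val mult.commute)
  also have "\<dots> = coeff g (card Y - 1)"
    by (rule lagrange_leading_coeff) (use assms card_S deg in auto)
  finally have *: "\<kappa> * (\<Sum>b\<in>Y. 1 / ((\<Prod>u\<in>Y - {b}. b - u) * (\<Prod>c\<in>S - {b}. b - c))) 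
     = coeff g (card Y - 1)" .
  have "coeff g (card Y - 1) = 0 \<longleftrightarrow> CARD('a) + 1 < card S + card Y"
  proof (cases "CARD('a) + 1 < card S + card Y")
    case True
    then show ?thesis using deg card_S by (auto intro!: coeff_eq_0)
  next
    case False
    then have "card Y - 1 = degree g" using deg card_S assms(2) by linarith
    then show ?thesis using lead False by simp
  qed
  then show ?thesis unfolding *[symmetric] mult_eq_0_iff using \<kappa> by simp
qed

lemma finite_field_power_card_minus_1:
  fixes x :: "'a::{field,finite}"
  assumes "x \<noteq> 0"
  shows "x ^ (CARD('a) - 1) = 1"
proof -
  have "(\<Prod>z\<in>UNIV - {0}. x * z) = (\<Prod>z\<in>UNIV - {0::'a}. z)"
    by (rule prod.reindex_bij_witness[of _ "\<lambda>z. z / x" "\<lambda>z. x * z"]) (use assms in auto)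
  then have "x ^ card (UNIV - {0::'a}) * (\<Prod>z\<in>UNIV - {0}. z) = (\<Prod>z\<in>UNIV - {0::'a}. z)"
    by (simp add: prod.distrib)
  then show ?thesis by (simp add: card_Diff_subset)
qed

text \<open>Homogeneous form of the preceding sum: with the affine coordinate
  \<open>s = E / D\<close>, the bracket \<open>\<omega> b c\<close> is
  \<open>D b * D c * (s b - s c)\<close>. The size condition makes the total exponent of
  \<open>D b\<close> in each denominator equal to \<open>CARD('a) - 1\<close>, so these powers
  disappear. The rest vanishes exactly if \<open>card C + card Y\<close> exceeds
  \<open>CARD('a) + 1\<close>, that is, for \<open>j = 1\<close>.\<close>

lemma binary_form_reciprocal_sum:
  fixes D E :: "'b \<Rightarrow> 'a::{field,finite}"
  defines "\<omega> \<equiv> \<lambda>b c. D c * E b - D b * E c"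
  assumes fin: "finite C" and YC: "Y \<subseteq> C" and D: "\<And>c. c \<in> C \<Longrightarrow> D c \<noteq> 0"
    and \<omega>: "\<And>b c. b \<in> C \<Longrightarrow> c \<in> C \<Longrightarrow> b \<noteq> c \<Longrightarrow> \<omega> b c \<noteq> 0"
    and j: "j + card Y + card C = CARD('a) + 3" "0 < j" "j \<le> 2" "Y \<noteq> {}"
  shows "(\<Sum>b\<in>Y. 1 / (D b ^ j * (\<Prod>u\<in>Y - {b}. \<omega> b u) * (\<Prod>c\<in>C - {b}. \<omega> b c))) = 0 \<longleftrightarrow> j = 1"
proof -
  define s where "s c = E c / D c" for c
  have \<omega>s: "\<omega> b c = D b * D c * (s b - s c)" if "b \<in> C" "c \<in> C" for b c
    using D[OF that(1)] D[OF that(2)] by (simp add: \<omega>_def s_def field_simps)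
  have inj: "inj_on s C"
  proof (rule inj_onI, rule ccontr)
    fix b c assume "b \<in> C" "c \<in> C" "s b = s c" "b \<noteq> c"
    then show False using \<omega>[of b c] \<omega>s[of b c] by simp
  qed
  have finY: "finite Y" using fin YC finite_subset by blast
  have nz: "card Y > 0" "card C > 0" "card Y \<le> card C"
    using finY fin YC j(4) by (auto simp: card_gt_0_iff card_mono)
  define \<rho> where "\<rho> = (\<Prod>u\<in>Y. D u) * (\<Prod>c\<in>C. D c)"
  have \<rho>: "\<rho> \<noteq> 0" using D YC fin finY by (auto simp: \<rho>_def)
  have summand: "D b ^ j * (\<Prod>u\<in>Y - {b}. \<omega> b u) * (\<Prod>c\<in>C - {b}. \<omega> b c)
      = \<rho> * ((\<Prod>u\<in>Y - {b}. s b - s u) * (\<Prod>c\<in>C - {b}. s b - s c))" if b: "b \<in> Y" for b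
  proof -
    have bC: "b \<in> C" using b YC by auto
    have Db: "D b \<noteq> 0" using D bC by auto
    have pY: "D b * (\<Prod>u\<in>Y - {b}. \<omega> b u) = D b ^ (card Y - 1) * (\<Prod>u\<in>Y. D u) * (\<Prod>u\<in>Y - {b}. s b - s u)"
    proof -
      have "(\<Prod>u\<in>Y - {b}. \<omega> b u) = (\<Prod>u\<in>Y - {b}. D b * D u * (s b - s u))"
        by (rule prod.cong) (use YC bC \<omega>s in auto)
      then show ?thesis
        using prod.remove[OF finY b, of D] finY b
        by (simp add: prod.distrib card_Diff_subset mult_ac)
    qed
    have pC: "D b * (\<Prod>u\<in>C - {b}. \<omega> b u) = D b ^ (card C - 1) * (\<Prod>u\<in>C. D u) * (\<Prod>u\<in>C - {b}. s b - s u)"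
    proof -
      have "(\<Prod>u\<in>C - {b}. \<omega> b u) = (\<Prod>u\<in>C - {b}. D b * D u * (s b - s u))"
        by (rule prod.cong) (use bC \<omega>s in auto)
      then show ?thesis
        using prod.remove[OF fin bC, of D] fin bC
        by (simp add: prod.distrib card_Diff_subset mult_ac)
    qed
    \<comment> \<open>The factor \<open>D b ^ 2\<close> completes both products of values of
      \<open>D\<close>, which then form the constant \<open>\<rho>\<close>.\<close>
    have "D b ^ 2 * (D b ^ j * (\<Prod>u\<in>Y - {b}. \<omega> b u) * (\<Prod>c\<in>C - {b}. \<omega> b c))
      = D b ^ j * (D b * (\<Prod>u\<in>Y - {b}. \<omega> b u)) * (D b * (\<Prod>u\<in>C - {b}. \<omega> b u))"
      by (simp add: power2_eq_square)
    also have "\<dots> = D b ^ (j + (card Y - 1) + (card C - 1)) *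
        (\<rho> * ((\<Prod>u\<in>Y - {b}. s b - s u) * (\<Prod>c\<in>C - {b}. s b - s c)))"
      unfolding pY pC \<rho>_def by (simp add: power_add mult_ac)
    also have "j + (card Y - 1) + (card C - 1) = 2 + (CARD('a) - 1)"
      using j nz by simp
    also have "D b ^ (2 + (CARD('a) - 1)) = D b ^ 2"
      unfolding power_add finite_field_power_card_minus_1[OF Db] by (rule mult.right_neutral)
    finally show ?thesis using Db by simp
  qed
  have re: "(\<Prod>u\<in>Z - {b}. s b - s u) = (\<Prod>u\<in>s ` Z - {s b}. s b - u)" if "Z \<subseteq> C" "b \<in> Z" for b Z
  proof -
    have "inj_on s (Z - {b})" using inj that by (meson Diff_subset inj_on_subset order.trans)
    moreover have "s ` Z - {s b} = s ` (Z - {b})"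
      using inj that by (auto simp: inj_on_def)
    ultimately show ?thesis by (simp add: prod.reindex)
  qed
  have "(\<Sum>b\<in>Y. 1 / (D b ^ j * (\<Prod>u\<in>Y - {b}. \<omega> b u) * (\<Prod>c\<in>C - {b}. \<omega> b c)))
      = (\<Sum>b\<in>Y. (1/\<rho>) * (1 / ((\<Prod>u\<in>s ` Y - {s b}. s b - u) * (\<Prod>c\<in>s ` C - {s b}. s b - c))))"
    by (rule sum.cong) (use YC re in \<open>auto simp: summand\<close>)
  also have "\<dots> = (1/\<rho>) * (\<Sum>b\<in>s ` Y. 1 / ((\<Prod>u\<in>s ` Y - {b}. b - u) * (\<Prod>c\<in>s ` C - {b}. b - c)))"
    using inj_on_subset[OF inj YC] by (simp add: sum_distrib_left sum.reindex)
  finally have "(\<Sum>b\<in>Y. 1 / (D b ^ j * (\<Prod>u\<in>Y - {b}. \<omega> b u) * (\<Prod>c\<in>C - {b}. \<omega> b c))) = 0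
      \<longleftrightarrow> (\<Sum>b\<in>s ` Y. 1 / ((\<Prod>u\<in>s ` Y - {b}. b - u) * (\<Prod>c\<in>s ` C - {b}. b - c))) = 0"
    using \<rho> by simp
  also have "\<dots> \<longleftrightarrow> CARD('a) + 1 < card (s ` C) + card (s ` Y)"
    by (rule finite_field_reciprocal_sum) (use YC j inj_on_subset[OF inj YC] inj in \<open>auto simp: card_image\<close>)
  also have "\<dots> \<longleftrightarrow> j = 1"
    using j inj_on_subset[OF inj YC] inj by (auto simp: card_image)
  finally show ?thesis .
qed

text \<open>The entries \<open>M a b\<close> and \<open>M b a\<close> cancel in pairs.\<close>

lemma symmetric_sum_char_2:
  fixes M :: "'b \<Rightarrow> 'b \<Rightarrow> 'a::comm_ring_1"
  assumes "finite X" and two: "(1::'a) + 1 = 0"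
    and "\<And>a b. a \<in> X \<Longrightarrow> b \<in> X \<Longrightarrow> M a b = M b a"
  shows "(\<Sum>a\<in>X. \<Sum>b\<in>X - {a}. M a b) = 0"
  using assms(1,3)
proof (induction X rule: finite_induct)
  case (insert x X)
  have dbl: "z + z = 0" for z :: 'a
    using two by (metis mult_zero_right distrib_left mult.right_neutral)
  have "(\<Sum>b\<in>insert x X - {a}. M a b) = M a x + (\<Sum>b\<in>X - {a}. M a b)" if "a \<in> X" for a
  proof -
    have "insert x X - {a} = insert x (X - {a})" using that insert.hyps by auto
    then show ?thesis using insert.hyps by simp
  qed
  moreover have "insert x X - {x} = X" using insert.hyps by auto
  ultimately have "(\<Sum>a\<in>insert x X. \<Sum>b\<in>insert x X - {a}. M a b)
      = (\<Sum>b\<in>X. M x b) + (\<Sum>a\<in>X. M a x) + (\<Sum>a\<in>X. \<Sum>b\<in>X - {a}. M a b)"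
    using insert.hyps by (simp add: sum.distrib)
  also have "(\<Sum>a\<in>X. M a x) = (\<Sum>b\<in>X. M x b)"
    by (rule sum.cong) (use insert.prems in auto)
  finally show ?case using insert dbl by simp
qed simp

section \<open>Determinants and the three-term Pluecker relation\<close>

fun det3 :: "'a::comm_ring_1 \<times> 'a \<times> 'a \<Rightarrow> 'a \<times> 'a \<times> 'a \<Rightarrow> 'a \<times> 'a \<times> 'a \<Rightarrow> 'a" where
  "det3 (a1, a2, a3) (b1, b2, b3) (c1, c2, c3) =
     a1 * (b2 * c3 - b3 * c2) - a2 * (b1 * c3 - b3 * c1) + a3 * (b1 * c2 - b2 * c1)"

lemma det3_swap: "det3 b a c = - det3 a b c"
  by (cases a; cases b; cases c) (simp add: algebra_simps)

text \<open>Both sides are linear in \<open>b\<close>, so it suffices to compare the coefficients of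
  \<open>b1\<close>, \<open>b2\<close> and \<open>b3\<close>, which are the cofactors
  \<open>m1\<close>, \<open>m2\<close> and \<open>m3\<close>. For fixed \<open>a\<close>,
  \<open>p\<close> and \<open>n\<close> the relation makes \<open>det3 a b c\<close> a bracket of
  \<open>b\<close> and \<open>c\<close>, the form needed for
  \<open>binary_form_reciprocal_sum\<close>.\<close>

lemma det3_pluecker:
  "det3 a p n * det3 a b c = det3 a c n * det3 a b p - det3 a b n * det3 a c p"
proof -
  obtain a1 a2 a3 b1 b2 b3 where ab: "a = (a1, a2, a3)" "b = (b1, b2, b3)"
    by (metis prod_cases3)
  define m1 m2 m3 where "m1 c = det3 a (1, 0, 0) c" and "m2 c = det3 a (0, 1, 0) c"
    and "m3 c = det3 a (0, 0, 1) c" for c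
  have expand: "det3 a b c = b1 * m1 c + b2 * m2 c + b3 * m3 c" for c
    by (cases c) (simp add: ab m1_def m2_def m3_def algebra_simps)
  have 1: "det3 a p n * m1 c = det3 a c n * m1 p - m1 n * det3 a c p"
    unfolding m1_def ab by (cases c; cases p; cases n) (simp add: algebra_simps)
  have 2: "det3 a p n * m2 c = det3 a c n * m2 p - m2 n * det3 a c p"
    unfolding m2_def ab by (cases c; cases p; cases n) (simp add: algebra_simps)
  have 3: "det3 a p n * m3 c = det3 a c n * m3 p - m3 n * det3 a c p"
    unfolding m3_def ab by (cases c; cases p; cases n) (simp add: algebra_simps)
  have "det3 a p n * det3 a b c = b1 * (det3 a p n * m1 c) + b2 * (det3 a p n * m2 c) + b3 * (det3 a p n * m3 c)"
    unfolding expand by (simp only: distrib_left mult.left_commute)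
  also have "\<dots> = det3 a c n * det3 a b p - det3 a b n * det3 a c p"
    unfolding expand 1 2 3 by (simp add: algebra_simps)
  finally show ?thesis .
qed

lemma char_2_neg:
  fixes x :: "'a::comm_ring_1"
  assumes "(1::'a) + 1 = 0"
  shows "- x = x"
proof -
  have "x + x = x * (1 + 1)" unfolding distrib_left by simp
  then show ?thesis using assms by (simp add: add.inverse_unique)
qed

text \<open>
  The points of \<open>X\<close> other than \<open>e\<close> see \<open>n\<close> along a tangent of the arc \<open>A\<close>, and \<open>e\<close> sees it along a
  secant.  By interpolation, row \<open>a\<close> of the matrix \<open>M\<close> below has sum zero exactly if \<open>a\<close> sees
  \<open>n\<close> along a tangent; but in characteristic 2 a symmetric matrix with empty diagonal has sum zero.
\<close>

lemma arc_tangent_contradiction: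
  fixes v :: "'b \<Rightarrow> 'a::{field,finite} \<times> 'a \<times> 'a" and n
  assumes two: "(1::'a) + 1 = 0"
    and fin: "finite A" and XA: "X \<subseteq> A" and card: "card X + card A = CARD('a) + 4"
    and arc: "\<And>a b c. a \<in> A \<Longrightarrow> b \<in> A \<Longrightarrow> c \<in> A \<Longrightarrow> a \<noteq> b \<Longrightarrow> a \<noteq> c \<Longrightarrow> b \<noteq> c \<Longrightarrow>
        det3 (v a) (v b) (v c) \<noteq> 0"
    and e: "e \<in> X" "X \<noteq> {e}" and e': "e' \<in> A - X" and secant: "det3 (v e) (v e') n = 0"
    and tangent: "\<And>a c. a \<in> X \<Longrightarrow> c \<in> A \<Longrightarrow> c \<noteq> a \<Longrightarrow> det3 (v a) (v c) n = 0 \<Longrightarrow> a = e \<and> c = e'"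
  shows False
proof -
  define w where "w a b c = det3 (v a) (v b) (v c)" for a b c
  define D where "D a b = det3 (v a) (v b) n" for a b
  \<comment> \<open>The points of \<open>X\<close> occur twice in the denominator, as
    \<open>X \<subseteq> A\<close>. Exchanging \<open>a\<close> and \<open>b\<close> affects only
    signs, which do not matter in characteristic 2.\<close>
  define M where "M a b = 1 / (D a b * (\<Prod>u\<in>X - {a} - {b}. w a b u) * (\<Prod>c\<in>A - {a} - {b}. w a b c))" for a b
  have D_sym: "D a b = D b a" for a b
    by (metis D_def char_2_neg[OF two] det3_swap)
  have w_sym: "w a b c = w b a c" for a b c
    by (metis w_def char_2_neg[OF two] det3_swap)
  have "M a b = M b a" for a b
  proof -
    have "X - {a} - {b} = X - {b} - {a}" "A - {a} - {b} = A - {b} - {a}" by auto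
    then show ?thesis unfolding M_def by (simp add: D_sym[of a b] w_sym[of a b])
  qed
  then have total: "(\<Sum>a\<in>X. \<Sum>b\<in>X - {a}. M a b) = 0"
    using symmetric_sum_char_2[of X M] finite_subset[OF XA fin] two by blast
  have finX: "finite X" using fin XA finite_subset by blast
  have cX: "card (X - {a}) = card X - 1" "card (A - {a}) = card A - 1" "0 < card X" "0 < card A" if "a \<in> X" for a
    using that XA fin finX by (auto simp: card_Diff_subset card_gt_0_iff)
  have split: "\<exists>E. \<forall>b c. w a b c = D a c * E b - D a b * E c" if "D a p \<noteq> 0" for a p
  proof (intro exI allI)
    fix b c
    have "D a p * w a b c = D a c * w a b p - D a b * w a c p"
      unfolding D_def w_def by (rule det3_pluecker)
    then show "w a b c = D a c * (w a b p / D a p) - D a b * (w a c p / D a p)"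
      using that by (simp add: field_simps)
  qed
  have w_nz: "w a b c \<noteq> 0" if "a \<in> A" "b \<in> A - {a}" "c \<in> A - {a}" "b \<noteq> c" for a b c
    using arc[of a b c] that by (auto simp: w_def)
  \<comment> \<open>Seen from \<open>a\<close>, no point of \<open>A\<close> is collinear with
    \<open>n\<close>, so every \<open>D a c\<close> is nonzero and the sizes fit the case
    \<open>j = 1\<close>.\<close>
  have row: "(\<Sum>b\<in>X - {a}. M a b) = 0" if a: "a \<in> X" "a \<noteq> e" for a
  proof -
    have Dnz: "D a c \<noteq> 0" if "c \<in> A - {a}" for c
      using tangent[of a c] a that by (auto simp: D_def)
    have "D a e \<noteq> 0" using Dnz[of e] a e XA by auto
    then obtain E where E: "\<And>b c. w a b c = D a c * E b - D a b * E c"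
      using split by blast
    have nz: "D a c * E b - D a b * E c \<noteq> 0" if "b \<in> A - {a}" "c \<in> A - {a}" "b \<noteq> c" for b c
      using w_nz[of a b c] that a XA unfolding E by auto
    have ne: "X - {a} \<noteq> {}" using a e by auto
    have "(\<Sum>b\<in>X - {a}. 1 / (D a b ^ 1 * (\<Prod>u\<in>X - {a} - {b}. w a b u) * (\<Prod>c\<in>A - {a} - {b}. w a b c))) = 0
        \<longleftrightarrow> 1 = (1::nat)"
      unfolding E
    proof (rule binary_form_reciprocal_sum)
      show "1 + card (X - {a}) + card (A - {a}) = CARD('a) + 3"
        using cX[OF a(1)] card by linarith
    qed (use fin XA Dnz nz ne in auto)
    then show ?thesis by (simp add: M_def)
  qed
  \<comment> \<open>Since \<open>D e e' = 0\<close>, the factor for \<open>e'\<close> is a constant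
    multiple of \<open>D e b\<close>. Taking it out of the product over \<open>A\<close> leaves one
    point fewer and a second factor \<open>D e b\<close>: this is the case \<open>j = 2\<close>,
    where the sum is nonzero.\<close>
  have "(\<Sum>b\<in>X - {e}. M e b) \<noteq> 0"
  proof -
    obtain p where p: "p \<in> X" "p \<noteq> e" using e by auto
    have Dnz: "D e c \<noteq> 0" if "c \<in> A - {e} - {e'}" for c
      using tangent[of e c] e that by (auto simp: D_def)
    have "D e p \<noteq> 0" using Dnz[of p] p e' XA by auto
    then obtain E where E: "\<And>b c. w e b c = D e c * E b - D e b * E c"
      using split by blast
    have e'A: "e' \<in> A" "e' \<noteq> e" using e e' by auto
    have De': "D e e' = 0" using secant by (simp add: D_def)
    have Ee': "E e' \<noteq> 0"
      using w_nz[of e p e'] e'A p e XA e' E[of p e'] De' by auto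
    have w_nz': "D e c * E b - D e b * E c \<noteq> 0" if "b \<in> A - {e}" "c \<in> A - {e}" "b \<noteq> c" for b c
      using w_nz[of e b c] that e XA unfolding E by auto
    have "(\<Sum>b\<in>X - {e}. 1 / (D e b ^ 2 * (\<Prod>u\<in>X - {e} - {b}. w e b u) * (\<Prod>c\<in>A - {e} - {e'} - {b}. w e b c))) = 0
        \<longleftrightarrow> 2 = (1::nat)"
      unfolding E
    proof (rule binary_form_reciprocal_sum)
      have "card (A - {e} - {e'}) = card A - 2"
        using fin e'A e XA by (subst card_Diff_singleton) (auto simp: card_Diff_singleton)
      moreover have "2 \<le> card A"
        using card_mono[OF fin, of "{e, e'}"] e'A e XA by auto
      ultimately show "2 + card (X - {e}) + card (A - {e} - {e'}) = CARD('a) + 3"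
        using cX[OF e(1)] card by linarith
    qed (use fin XA p e' Dnz w_nz' in auto)
    then have nz: "(\<Sum>b\<in>X - {e}. 1 / (D e b ^ 2 * (\<Prod>u\<in>X - {e} - {b}. w e b u) * (\<Prod>c\<in>A - {e} - {e'} - {b}. w e b c))) \<noteq> 0"
      by simp
    have "M e b = (- 1 / E e') * (1 / (D e b ^ 2 * (\<Prod>u\<in>X - {e} - {b}. w e b u) * (\<Prod>c\<in>A - {e} - {e'} - {b}. w e b c)))"
      if "b \<in> X - {e}" for b
    proof -
      have "(\<Prod>c\<in>A - {e} - {b}. w e b c) = w e b e' * (\<Prod>c\<in>A - {e} - {b} - {e'}. w e b c)"
        by (rule prod.remove) (use fin e'A e' that in auto)
      also have "A - {e} - {b} - {e'} = A - {e} - {e'} - {b}" by auto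
      also have "w e b e' = - (D e b * E e')" using E[of b e'] De' by simp
      finally show ?thesis by (simp add: M_def power2_eq_square)
    qed
    then have "(\<Sum>b\<in>X - {e}. M e b) = (- 1 / E e') *
      (\<Sum>b\<in>X - {e}. 1 / (D e b ^ 2 * (\<Prod>u\<in>X - {e} - {b}. w e b u) * (\<Prod>c\<in>A - {e} - {e'} - {b}. w e b c)))"
      unfolding sum_distrib_left by (intro sum.cong) auto
    then show ?thesis using nz Ee' by simp
  qed
  moreover have "(\<Sum>a\<in>X. \<Sum>b\<in>X - {a}. M a b) = (\<Sum>b\<in>X - {e}. M e b)"
    using row by (subst sum.remove[OF finX e(1)]) simp
  ultimately show False using total by simp
qed

section \<open>Subspaces over a finite field\<close>

lemma card_span_insert:
  fixes b :: "'a::{field,finite} ^ 'n::finite"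
  assumes "b \<notin> vec.span B"
  shows "card (vec.span (insert b B)) = CARD('a) * card (vec.span B)"
proof -
  have "bij_betw (\<lambda>(k, v). k *s b + v) (UNIV \<times> vec.span B) (vec.span (insert b B))"
    unfolding bij_betw_def
  proof
    show "inj_on (\<lambda>(k, v). k *s b + v) (UNIV \<times> vec.span B)"
    proof (rule inj_onI, clarify)
      fix k v k' v'
      assume v: "v \<in> vec.span B" "v' \<in> vec.span B" and eq: "k *s b + v = k' *s b + v'"
      have "(k - k') *s b = v' - v"
        using eq by (simp add: vec.scale_left_diff_distrib algebra_simps)
      then have "(k - k') *s b \<in> vec.span B"
        using v by (simp add: vec.span_diff)
      have "k = k'"
      proof (rule ccontr)
        assume "k \<noteq> k'"
        then have "b = inverse (k - k') *s ((k - k') *s b)"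
          unfolding vec.scale_scale by (subst left_inverse) simp_all
        also have "\<dots> \<in> vec.span B" by (rule vec.span_scale) fact
        finally show False using assms by simp
      qed
      then show "k = k' \<and> v = v'" using eq by simp
    qed
    show "(\<lambda>(k, v). k *s b + v) ` (UNIV \<times> vec.span B) = vec.span (insert b B)"
    proof (intro equalityI subsetI)
      fix x assume "x \<in> (\<lambda>(k, v). k *s b + v) ` (UNIV \<times> vec.span B)"
      then obtain k v where x: "x = k *s b + v" and "v \<in> vec.span B" by auto
      then have "x - k *s b \<in> vec.span B" by simp
      then show "x \<in> vec.span (insert b B)" unfolding vec.span_breakdown_eq by blast
    next
      fix x assume "x \<in> vec.span (insert b B)"
      then obtain k where "x - k *s b \<in> vec.span B" by (auto simp: vec.span_breakdown_eq)
      then show "x \<in> (\<lambda>(k, v). k *s b + v) ` (UNIV \<times> vec.span B)"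
        by (intro image_eqI[of _ _ "(k, x - k *s b)"]) auto
    qed
  qed
  then show ?thesis by (metis bij_betw_same_card card_cartesian_product)
qed

lemma card_subspace:
  fixes U :: "('a::{field,finite} ^ 'n::finite) set"
  assumes "vec.subspace U"
  shows "card U = CARD('a) ^ vec.dim U"
proof -
  obtain B where B: "B \<subseteq> U" "vec.independent B" "U \<subseteq> vec.span B" "card B = vec.dim U"
    using vec.basis_exists by blast
  have "card (vec.span B) = CARD('a) ^ card B"
    using finite[of B] B(2)
  proof (induction B rule: finite_induct)
    case (insert b B)
    then show ?case by (simp add: vec.independent_insert card_span_insert)
  qed simp
  moreover have "vec.span B = U"
    using B assms by (metis vec.span_subspace)
  ultimately show ?thesis using B by simp
qed

text \<open>These are the points of the quotient \<open>U / W\<close>. The points of a line, the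
  lines through a point and the planes through a line are all of this kind, so one counting argument
  serves for each.\<close>

definition between :: "('a::field ^ 'n::finite) set \<Rightarrow> ('a ^ 'n) set \<Rightarrow> ('a ^ 'n) set set" where
  "between W U = {S. vec.subspace S \<and> W \<subseteq> S \<and> S \<subseteq> U \<and> vec.dim S = Suc (vec.dim W)}"

lemma betweenD:
  assumes "S \<in> between W U"
  shows "vec.subspace S" "W \<subseteq> S" "S \<subseteq> U" "vec.dim S = Suc (vec.dim W)"
  using assms by (auto simp: between_def)

lemma dim_span_insert:
  assumes "vec.subspace W" "x \<notin> W"
  shows "vec.dim (vec.span (insert x W)) = Suc (vec.dim W)"
  using assms by (simp add: vec.dim_insert vec.span_eq_iff[THEN iffD2])

lemma span_insert_between:
  assumes "vec.subspace W" "vec.subspace U" "W \<subseteq> U" "x \<in> U" "x \<notin> W"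
  shows "vec.span (insert x W) \<in> between W U"
proof -
  have "vec.span (insert x W) \<subseteq> U" using assms by (intro vec.span_minimal) auto
  then show ?thesis using assms dim_span_insert[of W x] by (auto simp: between_def vec.span_base)
qed

lemma between_eq_span_insert:
  assumes "vec.subspace W" "S \<in> between W U" "x \<in> S" "x \<notin> W"
  shows "S = vec.span (insert x W)"
proof -
  have "vec.span (insert x W) \<subseteq> S"
    using assms(2,3) by (intro vec.span_minimal) (auto simp: between_def)
  moreover have "vec.dim S \<le> vec.dim (vec.span (insert x W))"
    using betweenD(4)[OF assms(2)] dim_span_insert[OF assms(1,4)] by simp
  ultimately show ?thesis
    using vec.subspace_dim_equal[of "vec.span (insert x W)" S] betweenD(1)[OF assms(2)] by auto
qed

lemma between_unique:
  assumes "vec.subspace W" "S \<in> between W U" "S' \<in> between W U'" "x \<in> S" "x \<in> S'" "x \<notin> W"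
  shows "S = S'"
  using between_eq_span_insert[OF assms(1,2,4,6)] between_eq_span_insert[OF assms(1,3,5,6)] by simp

lemma card_field_ge_2: "2 \<le> CARD('a::{field,finite})"
proof -
  have "card {0, 1::'a} \<le> CARD('a)" by (rule card_mono) auto
  then show ?thesis by simp
qed

text \<open>The sets \<open>S - W\<close> partition \<open>U - W\<close>. Keeping the factor
  \<open>CARD('a) - 1\<close> on the left avoids a division of natural numbers.\<close>

lemma card_between:
  fixes W U :: "('a::{field,finite} ^ 'n::finite) set"
  assumes "vec.subspace W" "vec.subspace U" "W \<subseteq> U" "vec.dim U = vec.dim W + m"
  shows "card (between W U) * (CARD('a) - 1) = CARD('a) ^ m - 1"
proof -
  let ?q = "CARD('a)" and ?w = "vec.dim W"
  have "card (U - W) = card (\<Union>S\<in>between W U. S - W)"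
  proof (rule arg_cong[where f = card], intro equalityI subsetI)
    fix x assume "x \<in> U - W"
    then show "x \<in> (\<Union>S\<in>between W U. S - W)"
      using span_insert_between[OF assms(1-3), of x] by (intro UN_I) (auto simp: vec.span_base)
  qed (auto simp: between_def)
  also have "\<dots> = (\<Sum>S\<in>between W U. card (S - W))"
  proof (rule card_UN_disjoint)
    show "\<forall>S\<in>between W U. \<forall>S'\<in>between W U. S \<noteq> S' \<longrightarrow> (S - W) \<inter> (S' - W) = {}"
      using between_unique[OF assms(1)] by blast
  qed auto
  also have "\<dots> = (\<Sum>S\<in>between W U. ?q ^ ?w * (?q - 1))"
    by (rule sum.cong)
      (auto simp: between_def card_Diff_subset card_subspace assms(1) diff_mult_distrib diff_mult_distrib2 mult.commute)
  finally have "card (U - W) = ?q ^ ?w * (card (between W U) * (?q - 1))"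
    by (simp add: mult_ac)
  moreover have "card (U - W) = ?q ^ ?w * (?q ^ m - 1)"
    using assms by (simp add: card_Diff_subset card_subspace diff_mult_distrib2 power_add)
  ultimately show ?thesis by simp
qed

lemma card_between_2:
  fixes W U :: "('a::{field,finite} ^ 'n::finite) set"
  assumes "vec.subspace W" "vec.subspace U" "W \<subseteq> U" "vec.dim U = vec.dim W + 2"
  shows "card (between W U) = CARD('a) + 1"
proof -
  \<comment> \<open>In this form \<open>CARD('a) - 1\<close> becomes \<open>r + 1\<close>, which is
    visibly nonzero and can be cancelled.\<close>
  obtain r where r: "CARD('a) = Suc (Suc r)"
    using card_field_ge_2[where 'a = 'a] by (metis add_2_eq_Suc le_Suc_ex)
  have "card (between W U) * (r + 1) = (CARD('a) + 1) * (r + 1)"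
    using card_between[OF assms] by (simp add: r power2_eq_square algebra_simps)
  then show ?thesis by (metis add_is_0 mult_cancel2 one_neq_zero)
qed

lemma card_between_3:
  fixes W U :: "('a::{field,finite} ^ 'n::finite) set"
  assumes "vec.subspace W" "vec.subspace U" "W \<subseteq> U" "vec.dim U = vec.dim W + 3"
  shows "card (between W U) = CARD('a) ^ 2 + CARD('a) + 1"
proof -
  obtain r where r: "CARD('a) = Suc (Suc r)"
    using card_field_ge_2[where 'a = 'a] by (metis add_2_eq_Suc le_Suc_ex)
  have "card (between W U) * (r + 1) = (CARD('a) ^ 2 + CARD('a) + 1) * (r + 1)"
    using card_between[OF assms] by (simp add: r power2_eq_square power3_eq_cube algebra_simps)
  then show ?thesis by (metis add_is_0 mult_cancel2 one_neq_zero)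
qed

section \<open>Points of the projective space\<close>

lemma pg_pointD:
  assumes "P \<in> pg_points"
  shows "vec.subspace P" "vec.dim P = 1"
  using assms by (auto simp: pg_points_def)

lemma pg_point_span:
  assumes "P \<in> pg_points" "x \<in> P" "x \<noteq> 0"
  shows "P = vec.span {x}"
  using assms pg_pointD[OF assms(1)] vec.subspace_dim_equal[of "vec.span {x}" P]
  by (simp add: vec.span_minimal)

lemma pg_point_obtain:
  assumes "P \<in> pg_points"
  obtains x where "x \<in> P" "x \<noteq> 0" "P = vec.span {x}"
proof -
  have "\<not> P \<subseteq> {0}" using pg_pointD[OF assms] vec.dim_eq_0[of P] by auto
  then show thesis using that pg_point_span[OF assms] by blast
qed

lemma pg_point_subset_iff:
  assumes "P \<in> pg_points" "x \<in> P" "x \<noteq> 0" "vec.subspace S"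
  shows "P \<subseteq> S \<longleftrightarrow> x \<in> S"
  using pg_point_span[OF assms(1-3)] assms by (metis empty_subsetI insert_subset subset_eq vec.span_minimal)

lemma pg_point_subset_eq:
  assumes "P \<in> pg_points" "Q \<in> pg_points" "P \<subseteq> Q"
  shows "P = Q"
  using assms vec.subspace_dim_equal[of P Q] by (auto simp: pg_points_def)

definition npts :: "('a::field ^ 'n::finite) set set \<Rightarrow> ('a ^ 'n) set \<Rightarrow> nat" where
  "npts K S = card {P \<in> K. P \<subseteq> S}"

lemma between_through_point_unique:
  assumes "vec.subspace W" "P \<in> pg_points" "S \<in> between W U" "S' \<in> between W U'" "P \<subseteq> S" "P \<subseteq> S'" "\<not> P \<subseteq> W"
  shows "S = S'"
  using assms between_unique by blast

lemma between_through_point_exists: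
  assumes "vec.subspace W" "vec.subspace U" "W \<subseteq> U" "P \<in> pg_points" "P \<subseteq> U" "\<not> P \<subseteq> W"
  shows "\<exists>S\<in>between W U. P \<subseteq> S"
proof -
  obtain x where x: "x \<in> P" "x \<noteq> 0" "P = vec.span {x}" using pg_point_obtain assms(4) by blast
  then have "x \<notin> W" using assms pg_point_subset_iff by blast
  then have "vec.span (insert x W) \<in> between W U" using assms x by (intro span_insert_between) auto
  then show ?thesis using x(3) by (metis empty_subsetI insert_mono vec.span_mono)
qed

text \<open>A point of \<open>K\<close> in \<open>U\<close> but not in \<open>W\<close> lies in
  exactly one member of \<open>between W U\<close>. The subtractions are exact because
  \<open>W\<close> is contained in each \<open>S\<close> and in \<open>U\<close>.\<close>

lemma sum_npts_between:
  fixes K :: "('a::{field,finite} ^ 'n::finite) set set"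
  assumes "K \<subseteq> pg_points" "vec.subspace W" "vec.subspace U" "W \<subseteq> U"
  shows "(\<Sum>S\<in>between W U. npts K S - npts K W) = npts K U - npts K W"
proof -
  have diff: "npts K S - npts K W = card {P \<in> K. P \<subseteq> S \<and> \<not> P \<subseteq> W}" if "W \<subseteq> S" for S
  proof -
    have "{P \<in> K. P \<subseteq> S \<and> \<not> P \<subseteq> W} = {P \<in> K. P \<subseteq> S} - {P \<in> K. P \<subseteq> W}" by auto
    then show ?thesis unfolding npts_def using that by (subst card_Diff_subset[symmetric]) auto
  qed
  have "{P \<in> K. P \<subseteq> U \<and> \<not> P \<subseteq> W} = (\<Union>S\<in>between W U. {P \<in> K. P \<subseteq> S \<and> \<not> P \<subseteq> W})"
    using between_through_point_exists[OF assms(2-4)] assms(1) by (fastforce dest: betweenD)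
  also have "card \<dots> = (\<Sum>S\<in>between W U. card {P \<in> K. P \<subseteq> S \<and> \<not> P \<subseteq> W})"
  proof (rule card_UN_disjoint)
    show "\<forall>i\<in>between W U. \<forall>j\<in>between W U. i \<noteq> j \<longrightarrow>
       {P \<in> K. P \<subseteq> i \<and> \<not> P \<subseteq> W} \<inter> {P \<in> K. P \<subseteq> j \<and> \<not> P \<subseteq> W} = {}"
      using between_through_point_unique[OF assms(2)] assms(1) by blast
  qed auto
  finally show ?thesis using diff betweenD(2) assms(4) by (metis (no_types, lifting) sum.cong)
qed

text \<open>The element -1 has an odd power equal to 1, namely the one with exponent
  \<open>CARD('a) - 1\<close>.\<close>

lemma char_2_if_even_card:
  assumes "even CARD('a::{field,finite})"
  shows "(1::'a) + 1 = 0"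
proof -
  have "odd (CARD('a) - 1)" using assms card_field_ge_2[where 'a = 'a] by simp
  then have "(- 1 :: 'a) = 1" using finite_field_power_card_minus_1[of "- 1 :: 'a"] by simp
  then show ?thesis by (metis add.right_inverse)
qed

text \<open>If some minor of the rows \<open>a\<close> and \<open>b\<close> is nonzero, cofactors
  serve as coefficients: two of the three equations hold identically, and the third says that the
  determinant is zero. If all these minors vanish, \<open>a\<close> and \<open>b\<close> are already
  dependent.\<close>

lemma det3_eq_0_dependent:
  fixes a1 :: "'a::field"
  assumes "det3 (a1, a2, a3) (b1, b2, b3) (c1, c2, c3) = 0"
  shows "\<exists>\<alpha> \<beta> \<gamma>. (\<alpha>, \<beta>, \<gamma>) \<noteq> (0, 0, 0) \<and> \<alpha> * a1 + \<beta> * b1 + \<gamma> * c1 = 0 \<and>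
    \<alpha> * a2 + \<beta> * b2 + \<gamma> * c2 = 0 \<and> \<alpha> * a3 + \<beta> * b3 + \<gamma> * c3 = 0"
    (is "\<exists>\<alpha> \<beta> \<gamma>. ?P \<alpha> \<beta> \<gamma>")
proof -
  have d: "a1 * (b2 * c3 - b3 * c2) - a2 * (b1 * c3 - b3 * c1) + a3 * (b1 * c2 - b2 * c1) = 0"
    using assms by simp
  consider "a2 * b3 - a3 * b2 \<noteq> 0" | "a1 * b3 - a3 * b1 \<noteq> 0" | "a1 * b2 - a2 * b1 \<noteq> 0"
    | "a2 * b3 - a3 * b2 = 0" "a1 * b3 - a3 * b1 = 0" "a1 * b2 - a2 * b1 = 0" by blast
  then show ?thesis
  proof cases
    case 1
    then have "?P (b2 * c3 - b3 * c2) (- (a2 * c3 - a3 * c2)) (a2 * b3 - a3 * b2)"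
      using d by (simp add: algebra_simps)
    then show ?thesis by blast
  next
    case 2
    then have "?P (- (b1 * c3 - b3 * c1)) (a1 * c3 - a3 * c1) (- (a1 * b3 - a3 * b1))"
      using d by (simp add: algebra_simps)
    then show ?thesis by blast
  next
    case 3
    then have "?P (b1 * c2 - b2 * c1) (- (a1 * c2 - a2 * c1)) (a1 * b2 - a2 * b1)"
      using d by (simp add: algebra_simps)
    then show ?thesis by blast
  next
    case 4
    consider "a1 \<noteq> 0" | "a2 \<noteq> 0" | "a3 \<noteq> 0" | "a1 = 0" "a2 = 0" "a3 = 0" by blast
    then show ?thesis
    proof cases
      case 1
      then have "?P b1 (- a1) 0" using 4 by (simp add: algebra_simps)
      then show ?thesis by blast
    next
      case 2
      then have "?P b2 (- a2) 0" using 4 by (simp add: algebra_simps)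
      then show ?thesis by blast
    next
      case 3
      then have "?P b3 (- a3) 0" using 4 by (simp add: algebra_simps)
      then show ?thesis by blast
    next
      assume "a1 = 0" "a2 = 0" "a3 = 0"
      then have "?P 1 0 0" by simp
      then show ?thesis by blast
    qed
  qed
qed

section \<open>Lines, and coordinates in a plane\<close>

lemma pg_linesD:
  assumes "L \<in> pg_lines"
  shows "vec.subspace L" "vec.dim L = 2"
  using assms by (auto simp: pg_lines_def)

lemma pg_line_between_iff:
  assumes "P \<in> pg_points"
  shows "L \<in> between P U \<longleftrightarrow> L \<in> pg_lines \<and> P \<subseteq> L \<and> L \<subseteq> U"
  using pg_pointD[OF assms] by (auto simp: between_def pg_lines_def)

lemma pg_line_unique:
  assumes "P \<in> pg_points" "Q \<in> pg_points" "P \<noteq> Q" "L \<in> pg_lines" "L' \<in> pg_lines"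
    "P \<subseteq> L" "Q \<subseteq> L" "P \<subseteq> L'" "Q \<subseteq> L'"
  shows "L = L'"
proof (rule between_through_point_unique)
  show "L \<in> between P UNIV" "L' \<in> between P UNIV" using assms by (auto simp: pg_line_between_iff)
  show "\<not> Q \<subseteq> P" using assms pg_point_subset_eq by blast
  show "vec.subspace P" using assms(1) by (rule pg_pointD)
qed (use assms in auto)

lemma pg_line_through_points:
  assumes P: "P \<in> pg_points" and Q: "Q \<in> pg_points" and "P \<noteq> Q"
    and u: "u \<in> P" "u \<noteq> 0" and v: "v \<in> Q" "v \<noteq> 0"
  shows "vec.span {u, v} \<in> pg_lines" "P \<subseteq> vec.span {u, v}" "Q \<subseteq> vec.span {u, v}"
proof -
  have "\<not> Q \<subseteq> P" using assms pg_point_subset_eq by blast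
  then have "v \<notin> P" using pg_point_subset_iff[OF Q v pg_pointD(1)[OF P]] by simp
  then have "v \<notin> vec.span {u}" using pg_point_span[OF P u] by simp
  then have "vec.dim {v, u} = 2" using u(2) by (simp add: vec.dim_insert)
  then show "vec.span {u, v} \<in> pg_lines" by (simp add: pg_lines_def insert_commute)
  show "P \<subseteq> vec.span {u, v}" "Q \<subseteq> vec.span {u, v}"
    using pg_point_span[OF P u] pg_point_span[OF Q v] vec.span_mono[of "{u}" "{u,v}"]
      vec.span_mono[of "{v}" "{u,v}"] by auto
qed

lemma plane_coordinates:
  fixes U :: "('a::{field,finite} ^ 'n::finite) set"
  assumes "vec.subspace U" "vec.dim U = 3"
  obtains b1 b2 b3 where
    "bij_betw (\<lambda>(x, y, z). x *s b1 + y *s b2 + z *s b3) UNIV U"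
proof -
  obtain B where B: "B \<subseteq> U" "vec.independent B" "U \<subseteq> vec.span B" "card B = vec.dim U"
    using vec.basis_exists by blast
  then obtain b1 b2 b3 where b: "B = {b1, b2, b3}"
    using assms by (auto simp: card_3_iff)
  let ?f = "\<lambda>(x, y, z). x *s b1 + y *s b2 + z *s b3"
  have U: "U = vec.span {b1, b2, b3}" using B assms(1) b by (metis vec.span_subspace)
  have range: "range ?f = U"
  proof (intro equalityI subsetI)
    fix v assume "v \<in> U"
    then obtain x y z where "v - x *s b1 - y *s b2 - z *s b3 = 0"
      unfolding U by (auto simp: vec.span_breakdown_eq)
    then have "v = ?f (x, y, z)" by (simp add: algebra_simps)
    then show "v \<in> range ?f" by blast
  next
    fix v assume "v \<in> range ?f"
    then obtain x y z where v: "v = x *s b1 + y *s b2 + z *s b3" by auto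
    have "x *s b1 \<in> U" "y *s b2 \<in> U" "z *s b3 \<in> U"
      unfolding U by (simp_all add: vec.span_scale vec.span_base)
    then show "v \<in> U" unfolding v using assms(1) by (simp add: vec.subspace_add)
  qed
  have "card (UNIV :: ('a \<times> 'a \<times> 'a) set) = card (range ?f)"
    unfolding range using card_subspace[OF assms(1)] assms(2)
    by (simp add: power3_eq_cube flip: UNIV_Times_UNIV)
  then have "inj ?f" by (simp add: eq_card_imp_inj_on)
  then show thesis using that range by (simp add: bij_betw_def)
qed

text \<open>With \<open>\<gamma> = 0\<close> the vectors \<open>u\<close> and \<open>v\<close> would
  be proportional, against \<open>P \<noteq> Q\<close>. Hence \<open>w\<close> is a combination of
  \<open>u\<close> and \<open>v\<close>.\<close>

lemma pg_collinear_if_dependent: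
  assumes pts: "P \<in> pg_points" "Q \<in> pg_points" "R \<in> pg_points" "P \<noteq> Q"
    and mem: "u \<in> P" "u \<noteq> 0" "v \<in> Q" "v \<noteq> 0" "w \<in> R" "w \<noteq> 0"
    and dep: "\<alpha> *s u + \<beta> *s v + \<gamma> *s w = 0" "(\<alpha>, \<beta>, \<gamma>) \<noteq> (0, 0, 0)"
  shows "\<exists>L\<in>pg_lines. P \<subseteq> L \<and> Q \<subseteq> L \<and> R \<subseteq> L"
proof -
  note L = pg_line_through_points[OF pts(1,2,4) mem(1-4)]
  have sub: "vec.subspace P" "vec.subspace Q" using pts pg_pointD by auto
  have "\<gamma> \<noteq> 0"
  proof
    assume [simp]: "\<gamma> = 0"
    have eq: "\<alpha> *s u = - \<beta> *s v" using dep(1) by (simp add: add_eq_0_iff)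
    show False
    proof (cases "\<alpha> = 0")
      case True
      then show False using dep eq mem by simp
    next
      case False
      then have "u = inverse \<alpha> *s (\<alpha> *s u)" by simp
      also have "\<dots> \<in> Q" unfolding eq by (intro vec.subspace_scale sub(2) mem(3))
      finally have "P \<subseteq> Q" using pg_point_subset_iff[OF pts(1) mem(1,2) sub(2)] by simp
      then show False using pts pg_point_subset_eq by blast
    qed
  qed
  have "\<gamma> *s w = - \<alpha> *s u - \<beta> *s v" using dep(1) by (simp add: algebra_simps eq_neg_iff_add_eq_0)
  then have "\<gamma> *s w \<in> vec.span {u, v}"
    by (simp add: vec.span_diff vec.span_scale vec.span_base vec.span_neg)
  then have "inverse \<gamma> *s (\<gamma> *s w) \<in> vec.span {u, v}" by (rule vec.span_scale)
  then have "w \<in> vec.span {u, v}" using \<open>\<gamma> \<noteq> 0\<close> by simp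
  then have "R \<subseteq> vec.span {u, v}"
    using pg_point_subset_iff[OF pts(3) mem(5,6)] by simp
  then show ?thesis using L by blast
qed

section \<open>Caps in three-dimensional space\<close>

lemma det3_combination:
  "det3 (a1, a2, a3) (b1, b2, b3) (x * a1 + y * b1, x * a2 + y * b2, x * a3 + y * b3) = 0"
  by (simp add: algebra_simps)

locale even_cap =
  fixes K :: "('a::{field,finite} ^ 4) set set" and q :: nat
  assumes card_field: "CARD('a) = q" and even_q: "even q" and cap_K: "cap (card K) K"
begin

lemma K_points: "P \<in> K \<Longrightarrow> P \<in> pg_points"
  using cap_K by (auto simp: cap_def)

lemma K_no_three_collinear:
  assumes "P \<in> K" "Q \<in> K" "R \<in> K" "P \<noteq> Q" "P \<noteq> R" "Q \<noteq> R" "L \<in> pg_lines" "P \<subseteq> L" "Q \<subseteq> L"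
  shows "\<not> R \<subseteq> L"
proof
  assume "R \<subseteq> L"
  then have "pg_collinear {P, Q, R}" using assms by (auto simp: pg_collinear_def)
  then show False using cap_K assms by (auto simp: cap_def)
qed

lemma npts_line_le_2:
  assumes "L \<in> pg_lines"
  shows "npts K L \<le> 2"
proof (rule ccontr)
  assume "\<not> npts K L \<le> 2"
  then have "3 \<le> card {P \<in> K. P \<subseteq> L}" by (simp add: npts_def)
  then obtain T where T: "T \<subseteq> {P \<in> K. P \<subseteq> L}" "card T = 3"
    by (rule obtain_subset_with_card_n)
  obtain P Q R where PQR: "T = {P, Q, R}" "P \<noteq> Q" "P \<noteq> R" "Q \<noteq> R"
    using card_3_iff[THEN iffD1, OF T(2)] by blast
  have "P \<in> K" "Q \<in> K" "R \<in> K" "P \<subseteq> L" "Q \<subseteq> L" "R \<subseteq> L"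
    using T(1) unfolding PQR(1) by (simp_all only: insert_subset mem_Collect_eq)
  then show False using K_no_three_collinear[of P Q R L] assms PQR by simp
qed

lemma npts_point: "P \<in> K \<Longrightarrow> npts K P = 1"
proof -
  assume P: "P \<in> K"
  then have "{P' \<in> K. P' \<subseteq> P} = {P}"
    using pg_point_subset_eq K_points by blast
  then show ?thesis by (simp add: npts_def)
qed

lemma npts_mono: "S \<subseteq> T \<Longrightarrow> npts K S \<le> npts K T"
  unfolding npts_def by (rule card_mono) auto

lemma npts_UNIV: "npts K UNIV = card K"
  by (simp add: npts_def)

lemma npts_pos_iff: "npts K S > 0 \<longleftrightarrow> (\<exists>P\<in>K. P \<subseteq> S)"
  by (auto simp: npts_def card_gt_0_iff)

section \<open>Tangents of a cap\<close>

definition tangents where "tangents = {L \<in> pg_lines. npts K L = 1}"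

lemma tangent_point_unique:
  assumes "L \<in> tangents" "P \<in> K" "P \<subseteq> L" "Q \<in> K" "Q \<subseteq> L"
  shows "P = Q"
proof -
  have "card {P \<in> K. P \<subseteq> L} = 1" using assms by (simp add: tangents_def npts_def)
  then obtain R where "{P \<in> K. P \<subseteq> L} = {R}" by (rule card_1_singletonE)
  then have "P \<in> {R}" "Q \<in> {R}" using assms by blast+
  then show ?thesis by simp
qed

lemma tangent_point:
  assumes "L \<in> tangents"
  obtains P where "P \<in> K" "P \<subseteq> L"
  using assms npts_pos_iff[of L] by (auto simp: tangents_def)

text \<open>A line through \<open>P\<close> carries one or two points of \<open>K\<close>. The lines
  of the second kind correspond to the other points of \<open>K\<close> in \<open>U\<close>; the
  remaining ones are the tangents.\<close>

lemma card_tangents_at: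
  assumes P: "P \<in> K" and U: "vec.subspace U" "P \<subseteq> U"
  shows "card {L \<in> tangents. P \<subseteq> L \<and> L \<subseteq> U} + npts K U = card (between P U) + 1"
proof -
  have iff: "L \<in> between P U \<longleftrightarrow> L \<in> pg_lines \<and> P \<subseteq> L \<and> L \<subseteq> U" for L
    using pg_line_between_iff K_points[OF P] by blast
  have sub: "vec.subspace P" using pg_pointD K_points[OF P] by blast
  have one: "1 \<le> npts K L \<and> npts K L \<le> 2" if "L \<in> between P U" for L
    using that npts_mono[of P L] npts_point[OF P] npts_line_le_2 iff by simp
  have tan: "{L \<in> tangents. P \<subseteq> L \<and> L \<subseteq> U} = {L \<in> between P U. npts K L = 1}"
    using iff by (auto simp: tangents_def)
  have "card (between P U) = (\<Sum>L\<in>between P U. (npts K L - 1) + (if npts K L = 1 then 1 else 0))"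
    unfolding card_eq_sum by (rule sum.cong) (use one in force)+
  also have "\<dots> = (\<Sum>L\<in>between P U. npts K L - 1) + card {L \<in> between P U. npts K L = 1}"
    by (simp add: sum.distrib sum.If_cases Int_def)
  also have "(\<Sum>L\<in>between P U. npts K L - 1) = npts K U - 1"
    using sum_npts_between[of K P U] K_points sub U npts_point[OF P] by auto
  finally show ?thesis
    using npts_mono[OF U(2)] npts_point[OF P] tan by simp
qed

lemma card_tangents_at_plane:
  assumes P: "P \<in> K" and U: "vec.subspace U" "P \<subseteq> U" "vec.dim U = 3"
  shows "card {L \<in> tangents. P \<subseteq> L \<and> L \<subseteq> U} + npts K U = q + 2"
  using card_tangents_at[OF P U(1,2)] card_between_2[of P U] U pg_pointD[OF K_points[OF P]] card_field
  by simp

lemma card_tangents_at_space: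
  assumes P: "P \<in> K"
  shows "card {L \<in> tangents. P \<subseteq> L} + card K = q ^ 2 + q + 2"
  using card_tangents_at[OF P, of UNIV] card_between_3[of P UNIV] pg_pointD[OF K_points[OF P]]
    card_field npts_UNIV by (simp add: card_cart_basis)

text \<open>Otherwise the contact points of sufficiently many tangents through \<open>N\<close>,
  together with one of the two cap points on \<open>S\<close>, form a set \<open>X\<close> as in
  \<open>arc_tangent_contradiction\<close>; the other cap point on \<open>S\<close> plays the part
  of \<open>e'\<close>.\<close>

lemma tangents_through_secant_point_plane:
  assumes U: "vec.subspace U" "vec.dim U = 3" and N: "N \<in> pg_points" "N \<notin> K"
    and S: "S \<in> pg_lines" "npts K S = 2" "N \<subseteq> S" "S \<subseteq> U"
  shows "card {L \<in> tangents. N \<subseteq> L \<and> L \<subseteq> U} + npts K U \<le> q + 2"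
proof (rule ccontr)
  assume many: "\<not> ?thesis"
  define A where "A = {P \<in> K. P \<subseteq> U}"
  define T where "T = {L \<in> tangents. N \<subseteq> L \<and> L \<subseteq> U}"
  have "card {P \<in> K. P \<subseteq> S} = 2" using S by (simp add: npts_def)
  then obtain e e' where ee': "{P \<in> K. P \<subseteq> S} = {e, e'}" "e \<noteq> e'" unfolding card_2_iff by blast
  have "e \<in> {P \<in> K. P \<subseteq> S}" "e' \<in> {P \<in> K. P \<subseteq> S}" unfolding ee'(1) by simp_all
  then have e: "e \<in> A" "e' \<in> A" "e \<subseteq> S" "e' \<subseteq> S" using S(4) unfolding A_def by blast+
  have on_S: "P = e \<or> P = e'" if "P \<in> K" "P \<subseteq> S" for P
    using that ee'(1) by blast
  have AK: "P \<in> K" "P \<in> pg_points" "P \<subseteq> U" "P \<noteq> N" if "P \<in> A" for P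
    using that K_points N by (auto simp: A_def)
  have nA: "card A = npts K U" by (simp add: A_def npts_def)
  have "card A \<le> q + 2" using card_tangents_at_plane[of e U] AK[OF e(1)] U nA by simp
  then have "q + 3 - card A \<le> card T" "0 < q + 3 - card A"
    using many nA by (auto simp: T_def)
  \<comment> \<open>This number of tangents gives \<open>card X + card A = q + 4\<close> once
    \<open>e\<close> is added to their contact points. It is positive, so \<open>X\<close> contains
    more than \<open>e\<close>.\<close>
  from this(1) obtain T' where T': "T' \<subseteq> T" "card T' = q + 3 - card A"
    by (rule obtain_subset_with_card_n)
  define pt where "pt L = (SOME P. P \<in> K \<and> P \<subseteq> L)" for L :: "('a ^ 4) set"
  have pt: "pt L \<in> K" "pt L \<subseteq> L" if "L \<in> T" for L
  proof -
    have "\<exists>P. P \<in> K \<and> P \<subseteq> L" using that tangent_point by (metis (no_types, lifting) T_def mem_Collect_eq)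
    then show "pt L \<in> K" "pt L \<subseteq> L" unfolding pt_def by (metis (mono_tags, lifting) someI_ex)+
  qed
  have TD: "L \<in> pg_lines" "N \<subseteq> L" "L \<subseteq> U" "L \<in> tangents" "npts K L = 1" if "L \<in> T" for L
    using that by (auto simp: T_def tangents_def)
  have ptA: "pt L \<in> A" if "L \<in> T" for L using pt[OF that] TD(3)[OF that] unfolding A_def by blast
  have line: "L = L'" if "L \<in> pg_lines" "L' \<in> pg_lines" "N \<subseteq> L" "N \<subseteq> L'" "P \<in> A" "P \<subseteq> L" "P \<subseteq> L'" for L L' P
    using pg_line_unique[of P N L L'] that AK N by auto
  \<comment> \<open>Two lines through \<open>N\<close> that share a contact point coincide.\<close>
  have inj: "inj_on pt T'"
  proof (rule inj_onI)
    fix L L' assume "L \<in> T'" "L' \<in> T'" "pt L = pt L'"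
    then show "L = L'" using T'(1) line[of L L' "pt L"] TD pt ptA by (metis subsetD)
  qed
  have pt_nS: "pt L \<notin> {e, e'}" if "L \<in> T" for L
  proof
    assume "pt L \<in> {e, e'}"
    then have "pt L \<subseteq> S" using e by blast
    then have "L = S" using line[of L S "pt L"] TD[OF that] S pt[OF that] ptA[OF that] by simp
    then show False using TD[OF that] S by simp
  qed
  define X where "X = insert e (pt ` T')"
  have XA: "X \<subseteq> A" using e ptA T' by (auto simp: X_def)
  have eX: "e \<notin> pt ` T'" "e' \<notin> X" using pt_nS T'(1) ee'(2) by (auto simp: X_def)
  have cardX: "card X + card A = CARD('a) + 4"
    using eX T'(2) card_image[OF inj] \<open>card A \<le> q + 2\<close> card_field by (simp add: X_def)
  have "X \<noteq> {e}"
  proof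
    assume "X = {e}"
    then have "pt ` T' = {}" using eX by (auto simp: X_def)
    then show False using T'(2) \<open>0 < q + 3 - card A\<close> by simp
  qed
  obtain b1 b2 b3 where bij: "bij_betw (\<lambda>(x, y, z). x *s b1 + y *s b2 + z *s b3) UNIV U"
    using plane_coordinates[OF U] by blast
  define f where "f = (\<lambda>(x, y, z). x *s b1 + y *s b2 + z *s b3)"
  have f: "inj f" "range f = U" using bij by (auto simp: bij_betw_def f_def)
  have f_lin: "f (\<alpha> * x1 + \<beta> * y1 + \<gamma> * z1, \<alpha> * x2 + \<beta> * y2 + \<gamma> * z2, \<alpha> * x3 + \<beta> * y3 + \<gamma> * z3)
      = \<alpha> *s f (x1, x2, x3) + \<beta> *s f (y1, y2, y3) + \<gamma> *s f (z1, z2, z3)"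
    for \<alpha> \<beta> \<gamma> x1 x2 x3 y1 y2 y3 z1 z2 z3
    by (simp add: f_def vec.scale_left_distrib vec.scale_right_distrib)
  define v where "v P = (SOME t. f t \<in> P \<and> f t \<noteq> 0)" for P
  have v: "f (v P) \<in> P" "f (v P) \<noteq> 0" if P: "P \<in> pg_points" "P \<subseteq> U" for P
  proof -
    obtain x where "x \<in> P" "x \<noteq> 0" using pg_point_obtain[OF P(1)] by blast
    moreover then obtain t where "x = f t" using P(2) f(2) by blast
    ultimately have "\<exists>t. f t \<in> P \<and> f t \<noteq> 0" by blast
    then show "f (v P) \<in> P" "f (v P) \<noteq> 0" unfolding v_def by (metis (mono_tags, lifting) someI_ex)+
  qed
  have collinear: "\<exists>L\<in>pg_lines. P \<subseteq> L \<and> Q \<subseteq> L \<and> R \<subseteq> L"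
    if pts: "P \<in> pg_points" "Q \<in> pg_points" "R \<in> pg_points" "P \<noteq> Q" "P \<subseteq> U" "Q \<subseteq> U" "R \<subseteq> U"
      and det: "det3 (v P) (v Q) (v R) = 0" for P Q R
  proof -
    obtain a1 a2 a3 b1 b2 b3 c1 c2 c3 where
      abc: "v P = (a1, a2, a3)" "v Q = (b1, b2, b3)" "v R = (c1, c2, c3)"
      by (metis prod_cases3)
    obtain \<alpha> \<beta> \<gamma> where dep: "(\<alpha>, \<beta>, \<gamma>) \<noteq> (0, 0, 0)" "\<alpha> * a1 + \<beta> * b1 + \<gamma> * c1 = 0"
      "\<alpha> * a2 + \<beta> * b2 + \<gamma> * c2 = 0" "\<alpha> * a3 + \<beta> * b3 + \<gamma> * c3 = 0"
      using det3_eq_0_dependent[of a1 a2 a3 b1 b2 b3 c1 c2 c3] det abc by auto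
    have "\<alpha> *s f (v P) + \<beta> *s f (v Q) + \<gamma> *s f (v R) = f (0, 0, 0)"
      using f_lin[of \<alpha> a1 \<beta> b1 \<gamma> c1 a2 b2 c2 a3 b3 c3] dep abc by simp
    also have "\<dots> = 0" by (simp add: f_def)
    finally have zero: "\<alpha> *s f (v P) + \<beta> *s f (v Q) + \<gamma> *s f (v R) = 0" .
    show ?thesis
      by (rule pg_collinear_if_dependent[OF pts(1-4) v[OF pts(1,5)] v[OF pts(2,6)] v[OF pts(3,7)]
            zero dep(1)])
  qed
  have NU: "N \<subseteq> U" using S by auto
  show False
  proof (rule arc_tangent_contradiction)
    show "(1::'a) + 1 = 0" using even_q card_field by (intro char_2_if_even_card) simp
    show "finite A" by simp
    show "X \<subseteq> A" "card X + card A = CARD('a) + 4" "e \<in> X" "X \<noteq> {e}" "e' \<in> A - X"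
      using XA cardX e(2) eX \<open>X \<noteq> {e}\<close> by (simp_all add: X_def)
    show "det3 (v a) (v b) (v c) \<noteq> 0"
      if abc: "a \<in> A" "b \<in> A" "c \<in> A" "a \<noteq> b" "a \<noteq> c" "b \<noteq> c" for a b c
    proof
      assume "det3 (v a) (v b) (v c) = 0"
      then obtain L where "L \<in> pg_lines" "a \<subseteq> L" "b \<subseteq> L" "c \<subseteq> L"
        using collinear[of a b c] abc AK by metis
      then show False using K_no_three_collinear[of a b c L] abc AK by metis
    qed
    show "det3 (v e) (v e') (v N) = 0"
    proof -
      have pe: "e \<in> pg_points" "e' \<in> pg_points" "e \<subseteq> U" "e' \<subseteq> U" using AK e by auto
      have ve: "f (v e) \<in> e" "f (v e) \<noteq> 0" "f (v e') \<in> e'" "f (v e') \<noteq> 0" using v pe by auto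
      have "S = vec.span {f (v e), f (v e')}"
        using pg_line_unique[OF pe(1,2) ee'(2) S(1)] pg_line_through_points[OF pe(1,2) ee'(2) ve] e by blast
      then have "f (v N) \<in> vec.span {f (v e), f (v e')}" using v[OF N(1) NU] S(3) by blast
      then obtain x y where "f (v N) - x *s f (v e) - y *s f (v e') = 0"
        by (auto simp: vec.span_breakdown_eq)
      then have eq: "f (v N) = x *s f (v e) + y *s f (v e')" by (simp add: algebra_simps)
      obtain a1 a2 a3 b1 b2 b3 where ab: "v e = (a1, a2, a3)" "v e' = (b1, b2, b3)"
        by (metis prod_cases3)
      have "f (v N) = f (x * a1 + y * b1, x * a2 + y * b2, x * a3 + y * b3)"
        using f_lin[of x a1 y b1 0 0 a2 b2 0 a3 b3 0] eq ab by simp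
      then have "v N = (x * a1 + y * b1, x * a2 + y * b2, x * a3 + y * b3)"
        using f(1) by (simp add: inj_eq)
      then show ?thesis using ab det3_combination by simp
    qed
    show "a = e \<and> c = e'" if a: "a \<in> X" and c: "c \<in> A" "c \<noteq> a" and det: "det3 (v a) (v c) (v N) = 0" for a c
    proof -
      have aA: "a \<in> A" using a XA by auto
      obtain L where L: "L \<in> pg_lines" "a \<subseteq> L" "c \<subseteq> L" "N \<subseteq> L"
        using collinear[of a c N] det aA c AK N NU by metis
      \<comment> \<open>The point \<open>e\<close> sees \<open>N\<close> along \<open>S\<close>,
        whose only cap points are \<open>e\<close> and \<open>e'\<close>; any other point of
        \<open>X\<close> sees \<open>N\<close> along a tangent, on which there is no second cap
        point.\<close>
      consider "a = e" | M where "M \<in> T" "a = pt M" using a T' by (auto simp: X_def)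
      then show ?thesis
      proof cases
        case 1
        then have "L = S" using line[of L S e] L S e by auto
        then have "c = e \<or> c = e'" using L AK[OF c(1)] on_S by blast
        then show ?thesis using 1 c by auto
      next
        case (2 M)
        then have "L = M" using line[of L M a] L TD pt aA by auto
        then have "c = a" using tangent_point_unique[of M c a] TD AK 2 L c aA by blast
        then show ?thesis using c by simp
      qed
    qed
  qed
qed

end

section \<open>Finite linear spaces\<close>

text \<open>Inclusion and exclusion: each of the six pairs accounts for at most one common
  point.\<close>

lemma four_large_blocks:
  fixes A1 A2 A3 A4 :: "'p set"
  assumes "finite T" "A1 \<subseteq> T" "A2 \<subseteq> T" "A3 \<subseteq> T" "A4 \<subseteq> T"
    and "card (A1 \<inter> A2) \<le> 1" "card (A1 \<inter> A3) \<le> 1" "card (A1 \<inter> A4) \<le> 1"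
      "card (A2 \<inter> A3) \<le> 1" "card (A2 \<inter> A4) \<le> 1" "card (A3 \<inter> A4) \<le> 1"
  shows "card A1 + card A2 + card A3 + card A4 \<le> card T + 6"
proof -
  have fin: "finite A1" "finite A2" "finite A3" "finite A4"
    using assms(1-5) finite_subset by blast+
  have "card (A1 \<union> A2) + card (A1 \<inter> A2) = card A1 + card A2"
    using card_Un_Int fin by metis
  moreover have "card (A1 \<union> A2 \<union> A3) + card ((A1 \<union> A2) \<inter> A3) = card (A1 \<union> A2) + card A3"
    using card_Un_Int fin by (metis finite_UnI)
  moreover have "card ((A1 \<union> A2) \<inter> A3) \<le> card (A1 \<inter> A3) + card (A2 \<inter> A3)"
    unfolding Int_Un_distrib2 by (rule card_Un_le)
  moreover have "card (A1 \<union> A2 \<union> A3 \<union> A4) + card ((A1 \<union> A2 \<union> A3) \<inter> A4) = card (A1 \<union> A2 \<union> A3) + card A4"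
    using card_Un_Int fin by (metis finite_UnI)
  moreover have "card ((A1 \<union> A2 \<union> A3) \<inter> A4) \<le> card (A1 \<inter> A4) + card (A2 \<inter> A4) + card (A3 \<inter> A4)"
    unfolding Int_Un_distrib2 by (meson add_right_mono card_Un_le order_trans)
  moreover have "card (A1 \<union> A2 \<union> A3 \<union> A4) \<le> card T"
    using assms by (intro card_mono) auto
  ultimately show ?thesis using assms by linarith
qed

text \<open>Blocks are indices with a point set \<open>inc B\<close> rather than the point sets
  themselves: distinct planes may contain the same tangents at a point when there is at most one of
  them, and must still be counted separately.\<close>

locale linear_space =
  fixes T :: "'p set" and Bs :: "'b set" and inc :: "'b \<Rightarrow> 'p set"
  assumes fin: "finite T" "finite Bs"
    and inc_sub: "B \<in> Bs \<Longrightarrow> inc B \<subseteq> T"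
    and join: "x \<in> T \<Longrightarrow> y \<in> T \<Longrightarrow> x \<noteq> y \<Longrightarrow> \<exists>B\<in>Bs. x \<in> inc B \<and> y \<in> inc B"
    and join_unique: "B \<in> Bs \<Longrightarrow> B' \<in> Bs \<Longrightarrow> x \<in> inc B \<Longrightarrow> y \<in> inc B \<Longrightarrow> x \<in> inc B' \<Longrightarrow> y \<in> inc B' \<Longrightarrow>
      x \<noteq> y \<Longrightarrow> B = B'"
begin

lemma finite_inc: "B \<in> Bs \<Longrightarrow> finite (inc B)"
  using fin inc_sub finite_subset by metis

lemma card_Int_inc_le_1:
  assumes "B \<in> Bs" "B' \<in> Bs" "B \<noteq> B'"
  shows "card (inc B \<inter> inc B') \<le> 1"
  using join_unique[OF assms(1,2)] assms(3) finite_inc[OF assms(1)]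
  by (simp add: card_le_Suc0_iff_eq) blast

text \<open>The blocks through \<open>x\<close> partition the points other than
  \<open>x\<close>.\<close>

lemma sum_card_inc:
  assumes x: "x \<in> T"
  shows "(\<Sum>B\<in>{B \<in> Bs. x \<in> inc B}. card (inc B) - 1) = card T - 1"
proof -
  have "card (T - {x}) = card (\<Union>B\<in>{B \<in> Bs. x \<in> inc B}. inc B - {x})"
  proof (rule arg_cong[where f = card], intro equalityI subsetI)
    fix y assume "y \<in> T - {x}"
    then show "y \<in> (\<Union>B\<in>{B \<in> Bs. x \<in> inc B}. inc B - {x})" using join[OF x, of y] by blast
  qed (use inc_sub in blast)
  also have "\<dots> = (\<Sum>B\<in>{B \<in> Bs. x \<in> inc B}. card (inc B - {x}))"
  proof (rule card_UN_disjoint)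
    show "\<forall>B\<in>{B \<in> Bs. x \<in> inc B}. \<forall>B'\<in>{B \<in> Bs. x \<in> inc B}. B \<noteq> B' \<longrightarrow>
        (inc B - {x}) \<inter> (inc B' - {x}) = {}"
      using join_unique by blast
  qed (use fin finite_inc in auto)
  finally show ?thesis using x fin by simp
qed

text \<open>The condition \<open>squares\<close> demands a large block at every point, whereas
  blocks share at most one point and so only few large ones fit into \<open>T\<close>. These demands
  conflict if \<open>card T \<le> 2 * q - 2\<close>.\<close>

lemma card_points_ge:
  fixes q :: nat
  assumes q: "even q" "q \<ge> 4"
    and size: "\<And>B. B \<in> Bs \<Longrightarrow> card (inc B) \<le> q + 1"
    and large: "q + 1 < card T"
    and squares: "\<And>x. x \<in> T \<Longrightarrow>
      q ^ 2 + q + 1 \<le> (\<Sum>B\<in>{B \<in> Bs. x \<in> inc B}. (card (inc B) - 1) ^ 2) + card T"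
  shows "2 * q \<le> card T + 1"
proof (rule ccontr)
  assume "\<not> 2 * q \<le> card T + 1"
  then have t: "card T + 2 \<le> 2 * q" by simp
  define m where "m B = card (inc B) - 1" for B
  \<comment> \<open>A long block has at least \<open>q / 2 + 2\<close> points. As \<open>q\<close>
    is even, a block through a point that is not long satisfies
    \<open>m B \<le> q / 2\<close>.\<close>
  define long where "long = {B \<in> Bs. q + 2 \<le> 2 * m B}"
  have longD: "B \<in> Bs" "q + 4 \<le> 2 * card (inc B)" "q + 2 \<le> 2 * m B" if "B \<in> long" for B
    using that by (auto simp: long_def m_def)
  have sum_m: "(\<Sum>B\<in>{B \<in> Bs. x \<in> inc B}. m B) = card T - 1" if "x \<in> T" for x
    unfolding m_def by (rule sum_card_inc[OF that])
  have sq: "q ^ 2 + q + 1 \<le> (\<Sum>B\<in>{B \<in> Bs. x \<in> inc B}. m B ^ 2) + card T" if "x \<in> T" for x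
    unfolding m_def by (rule squares[OF that])
  have long_ex: "\<exists>B\<in>long. x \<in> inc B" if x: "x \<in> T" for x
  proof (rule ccontr)
    assume none: "\<not> (\<exists>B\<in>long. x \<in> inc B)"
    have le: "2 * m B \<le> q" if "B \<in> Bs" "x \<in> inc B" for B
    proof -
      have "2 * m B < q + 2" using none that by (force simp: long_def)
      then show ?thesis using q(1) by presburger
    qed
    \<comment> \<open>Without long blocks at \<open>x\<close> the sum of squares is at most
      \<open>q / 2\<close> times \<open>card T - 1\<close>, too little for
      \<open>squares\<close>.\<close>
    have "2 * (\<Sum>B\<in>{B \<in> Bs. x \<in> inc B}. m B ^ 2) \<le> q * (\<Sum>B\<in>{B \<in> Bs. x \<in> inc B}. m B)"
      unfolding sum_distrib_left
    proof (rule sum_mono)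
      fix B assume "B \<in> {B \<in> Bs. x \<in> inc B}"
      then show "2 * m B ^ 2 \<le> q * m B" using mult_right_mono[OF le, of B "m B"]
        by (simp add: power2_eq_square mult.assoc)
    qed
    then have "2 * (q ^ 2 + q + 1) \<le> q * (card T - 1) + 2 * card T"
      using sum_m[OF x] sq[OF x] by simp
    also have "\<dots> \<le> q * (2 * q - 3) + 2 * (2 * q - 2)"
      using t by (intro add_mono mult_left_mono) auto
    finally show False using q(2) by (simp add: power2_eq_square diff_mult_distrib2)
  qed
  \<comment> \<open>Four long blocks have sizes adding up to at least \<open>2 * q + 8\<close>, but
    \<open>card T + 6\<close> is at most \<open>2 * q + 4\<close>.\<close>
  have no_four: False if "B1 \<in> long" "B2 \<in> long" "B3 \<in> long" "B4 \<in> long" "distinct [B1, B2, B3, B4]" for B1 B2 B3 B4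
  proof -
    have "card (inc B1) + card (inc B2) + card (inc B3) + card (inc B4) \<le> card T + 6"
      by (rule four_large_blocks[OF fin(1)]; (rule inc_sub | rule card_Int_inc_le_1))
        (use that longD in auto)
    then show False using longD(2)[OF that(1)] longD(2)[OF that(2)] longD(2)[OF that(3)] longD(2)[OF that(4)] t
      by linarith
  qed
  have very_long: "q \<le> m L + 1" if L: "L \<in> long" for L
  proof -
    \<comment> \<open>There are at most two other long blocks, each meeting \<open>L\<close> in at
      most one point, while \<open>L\<close> has at least four points.\<close>
    have "\<exists>x\<in>inc L. \<forall>M\<in>long. x \<in> inc M \<longrightarrow> M = L"
    proof (rule ccontr)
      assume "\<not> ?thesis"
      then have "inc L \<subseteq> (\<Union>M\<in>long - {L}. inc M \<inter> inc L)" by blast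
      moreover have fin_long: "finite long" using fin by (simp add: long_def)
      ultimately have "card (inc L) \<le> card (\<Union>M\<in>long - {L}. inc M \<inter> inc L)"
        using finite_inc longD(1) by (intro card_mono) auto
      also have "\<dots> \<le> (\<Sum>M\<in>long - {L}. card (inc M \<inter> inc L))"
        using fin_long by (intro card_UN_le) auto
      also have "\<dots> \<le> (\<Sum>M\<in>long - {L}. 1)"
        using card_Int_inc_le_1 longD L by (intro sum_mono) auto
      also have "\<dots> = card (long - {L})" by simp
      finally have "3 \<le> card (long - {L})" using longD(2)[OF L] q(2) by linarith
      then obtain F where "F \<subseteq> long - {L}" "card F = 3" by (rule obtain_subset_with_card_n)
      then obtain B1 B2 B3 where "{B1, B2, B3} \<subseteq> long - {L}" "B1 \<noteq> B2" "B1 \<noteq> B3" "B2 \<noteq> B3"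
        unfolding card_3_iff by blast
      then show False using no_four[of L B1 B2 B3] L by auto
    qed
    then obtain x where x: "x \<in> inc L" "\<And>M. M \<in> long \<Longrightarrow> x \<in> inc M \<Longrightarrow> M = L" by blast
    have xT: "x \<in> T" using x L longD inc_sub by blast
    let ?r = "{B \<in> Bs. x \<in> inc B}"
    \<comment> \<open>Three points of \<open>M\<close> other than \<open>x\<close> would lie on long
      blocks different from \<open>L\<close> and \<open>M\<close>. These are pairwise distinct,
      since two of the points determine \<open>M\<close>, so with \<open>L\<close> there would be
      four long blocks.\<close>
    have small: "m M \<le> 2" if M: "M \<in> ?r - {L}" for M
    proof (rule ccontr)
      assume "\<not> m M \<le> 2"
      then have "3 \<le> card (inc M - {x})" using M finite_inc by (simp add: m_def)
      then obtain F where "F \<subseteq> inc M - {x}" "card F = 3" by (rule obtain_subset_with_card_n)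
      then obtain y1 y2 y3 where y: "{y1, y2, y3} \<subseteq> inc M - {x}" "y1 \<noteq> y2" "y1 \<noteq> y3" "y2 \<noteq> y3"
        unfolding card_3_iff by blast
      have y_long: "\<exists>B\<in>long. y \<in> inc B \<and> B \<noteq> L \<and> B \<noteq> M" if yM: "y \<in> inc M - {x}" for y
      proof -
        obtain B where B: "B \<in> long" "y \<in> inc B" using long_ex[of y] yM M inc_sub by blast
        have "B \<noteq> L" using join_unique[of M L x y] M B yM x L longD by blast
        moreover have "B \<noteq> M" using x(2) M B by blast
        ultimately show ?thesis using B by blast
      qed
      obtain B1 B2 B3 where B: "B1 \<in> long" "B2 \<in> long" "B3 \<in> long" "y1 \<in> inc B1" "y2 \<in> inc B2" "y3 \<in> inc B3"
         "L \<noteq> B1" "L \<noteq> B2" "L \<noteq> B3" "B1 \<noteq> M" "B2 \<noteq> M" "B3 \<noteq> M"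
        using y_long y(1) by (metis insert_subset)
      have "B1 \<noteq> B2" using join_unique[of M B1 y1 y2] M B y longD by blast
      moreover have "B1 \<noteq> B3" using join_unique[of M B1 y1 y3] M B y longD by blast
      moreover have "B2 \<noteq> B3" using join_unique[of M B2 y2 y3] M B y longD by blast
      ultimately show False using no_four[of L B1 B2 B3] L B by simp
    qed
    have r: "finite ?r" "L \<in> ?r" using fin(2) x(1) longD(1)[OF L] by simp_all
    have "(\<Sum>B\<in>?r - {L}. m B ^ 2) \<le> (\<Sum>B\<in>?r - {L}. 2 * m B)"
      by (rule sum_mono) (use small in \<open>simp add: power2_eq_square\<close>)
    also have "\<dots> = 2 * (\<Sum>B\<in>?r - {L}. m B)" by (simp add: sum_distrib_left)
    finally have "q ^ 2 + q + 1 + 2 * m L \<le> m L ^ 2 + 2 * (card T - 1) + card T"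
      using sq[OF xT] sum_m[OF xT] sum.remove[OF r, of m] sum.remove[OF r, of "\<lambda>B. m B ^ 2"] by linarith
    then have "q ^ 2 + 2 * m L + 9 \<le> m L ^ 2 + 5 * q"
      using t large by linarith
    then have main: "int q ^ 2 + 2 * int (m L) + 9 \<le> int (m L) ^ 2 + 5 * int q"
      by (metis (mono_tags, lifting) of_nat_le_iff of_nat_add of_nat_mult of_nat_numeral of_nat_power)
    show ?thesis
    proof (rule ccontr)
      assume "\<not> q \<le> m L + 1"
      \<comment> \<open>Expanded, this says
        \<open>m L ^ 2 \<le> q ^ 2 - 6 * q + 8 + 2 * m L\<close>, and \<open>main\<close> would make
        \<open>q\<close> negative.\<close>
      then have "0 \<le> (int q - 2 - int (m L)) * (int q - 4 + int (m L))"
        using q(2) by (intro mult_nonneg_nonneg) auto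
      then show False using main q(2) by (simp add: power2_eq_square algebra_simps)
    qed
  qed
  obtain x where x: "x \<in> T" using large by fastforce
  obtain L where L: "L \<in> long" "x \<in> inc L" using long_ex[OF x] by blast
  \<comment> \<open>A block is smaller than \<open>T\<close>, so a second long block is needed. Two
    blocks with at least \<open>q\<close> points each and at most one in common cover
    \<open>2 * q - 1\<close> points.\<close>
  have "\<not> T \<subseteq> inc L"
    using size[OF longD(1)[OF L(1)]] large card_mono[OF finite_inc[OF longD(1)[OF L(1)]], of T] by linarith
  then obtain y where y: "y \<in> T" "y \<notin> inc L" by blast
  obtain L' where L': "L' \<in> long" "y \<in> inc L'" using long_ex[OF y(1)] by blast
  have "L \<noteq> L'" using y L' by blast
  then have "card (inc L \<inter> inc L') \<le> 1" using card_Int_inc_le_1 longD L L' by blast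
  moreover have "card (inc L \<union> inc L') \<le> card T"
    using fin inc_sub longD L L' by (intro card_mono) auto
  moreover have "card (inc L \<union> inc L') + card (inc L \<inter> inc L') = card (inc L) + card (inc L')"
    using card_Un_Int finite_inc longD L L' by metis
  ultimately show False
    using very_long[OF L(1)] very_long[OF L'(1)] longD(2)[OF L(1)] longD(2)[OF L'(1)] t q(2)
    by (simp add: m_def)
qed

end

section \<open>Complete caps\<close>

lemma pg_line_subset:
  assumes "P \<in> pg_points" "Q \<in> pg_points" "P \<noteq> Q" "L \<in> pg_lines" "P \<subseteq> L" "Q \<subseteq> L"
    "vec.subspace U" "P \<subseteq> U" "Q \<subseteq> U"
  shows "L \<subseteq> U"
proof -
  obtain u where u: "u \<in> P" "u \<noteq> 0" using pg_point_obtain[OF assms(1)] by metis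
  obtain v where v: "v \<in> Q" "v \<noteq> 0" using pg_point_obtain[OF assms(2)] by metis
  note span = pg_line_through_points[OF assms(1-3) u v]
  have "L = vec.span {u, v}" using pg_line_unique[OF assms(1-4) span(1) assms(5,6) span(2,3)] .
  also have "\<dots> \<subseteq> U" using assms(7-9) u v by (intro vec.span_minimal) auto
  finally show ?thesis .
qed

lemma span_pg_point: "x \<noteq> 0 \<Longrightarrow> vec.span {x} \<in> pg_points"
  by (simp add: pg_points_def)

lemma card_pg_points_in_line:
  fixes L :: "('a::{field,finite} ^ 'n::finite) set"
  assumes "L \<in> pg_lines"
  shows "card {Q \<in> pg_points. Q \<subseteq> L} = CARD('a) + 1"
proof -
  have eq: "between {0} L = {Q \<in> pg_points. Q \<subseteq> L}"
    by (auto simp: between_def pg_points_def vec.subspace_0)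
  show "card {Q \<in> pg_points. Q \<subseteq> L} = CARD('a) + 1"
    using card_between_2[of "{0}" L] pg_linesD[OF assms] vec.subspace_0[of L]
    unfolding eq by (simp add: vec.subspace_single_0)
qed

text \<open>By the dimension formula the intersection has dimension at least 2 + 2 - 3 = 1.\<close>

lemma coplanar_lines_meet:
  assumes "L \<in> pg_lines" "M \<in> pg_lines" "vec.subspace U" "vec.dim U = 3" "L \<subseteq> U" "M \<subseteq> U"
  shows "\<exists>Q\<in>pg_points. Q \<subseteq> L \<and> Q \<subseteq> M"
proof -
  note LM = pg_linesD[OF assms(1)] pg_linesD[OF assms(2)]
  have "{x + y |x y. x \<in> L \<and> y \<in> M} \<subseteq> U"
  proof clarify
    fix x y assume "x \<in> L" "y \<in> M"
    then have "x \<in> U" "y \<in> U" using assms(5,6) by blast+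
    then show "x + y \<in> U" by (rule vec.subspace_add[OF assms(3)])
  qed
  then have "vec.dim {x + y |x y. x \<in> L \<and> y \<in> M} \<le> vec.dim U"
    by (rule vec.dim_subset)
  then have "vec.dim (L \<inter> M) \<noteq> 0"
    using vec.dim_sums_Int[OF LM(1,3)] LM(2,4) assms(4) by linarith
  then have "\<not> L \<inter> M \<subseteq> {0}" by simp
  then obtain x where x: "x \<in> L" "x \<in> M" "x \<noteq> 0" by blast
  then have "vec.span {x} \<subseteq> L" "vec.span {x} \<subseteq> M"
    using LM by (simp_all add: vec.span_minimal)
  then show ?thesis using span_pg_point[OF x(3)] by blast
qed

text \<open>Completeness enters as \<open>secant_ex\<close>: a point outside \<open>K\<close> that
  lies on no secant could be added to the cap.\<close>

locale complete_even_cap = even_cap +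
  assumes q_ge_4: "q \<ge> 4" and nonempty: "K \<noteq> {}"
    and secant_ex: "N \<in> pg_points \<Longrightarrow> N \<notin> K \<Longrightarrow> \<exists>S\<in>pg_lines. npts K S = 2 \<and> N \<subseteq> S"
begin

lemma planes_through_line:
  assumes "L \<in> pg_lines"
  shows "card (between L (UNIV :: ('a ^ 4) set)) = q + 1"
  using card_between_2[of L UNIV] pg_linesD[OF assms] card_field by (simp add: card_cart_basis)

text \<open>Let \<open>S\<close> be a secant through \<open>N\<close>. Every tangent through
  \<open>N\<close> lies in a plane through \<open>S\<close>, and such a plane with \<open>n\<close>
  cap points contains at most \<open>q + 2 - n\<close> of them. Over the \<open>q + 1\<close> planes
  through \<open>S\<close> these bounds add up to \<open>(q + 1) * q - (card K - 2)\<close>, which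
  is the number of tangents at a point of \<open>K\<close>.\<close>

lemma tangents_through_external_point:
  assumes N: "N \<in> pg_points" "N \<notin> K"
  shows "card {L \<in> tangents. N \<subseteq> L} + card K \<le> q ^ 2 + q + 2"
proof -
  obtain S where S: "S \<in> pg_lines" "npts K S = 2" "N \<subseteq> S" using secant_ex[OF N] by blast
  let ?B = "between S (UNIV :: ('a ^ 4) set)"
  note Ssub = pg_linesD[OF S(1)]
  have "{L \<in> tangents. N \<subseteq> L} \<subseteq> (\<Union>U\<in>?B. {L \<in> tangents. N \<subseteq> L \<and> L \<subseteq> U})"
  proof
    fix L assume "L \<in> {L \<in> tangents. N \<subseteq> L}"
    then have L: "L \<in> tangents" "N \<subseteq> L" "L \<in> pg_lines" "npts K L = 1" by (auto simp: tangents_def)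
    obtain P where P: "P \<in> K" "P \<subseteq> L" using tangent_point[OF L(1)] by blast
    have PN: "P \<in> pg_points" "P \<noteq> N" using P N K_points by auto
    have "\<not> P \<subseteq> S"
    proof
      assume "P \<subseteq> S"
      then have "L = S" using pg_line_unique[OF PN(1) N(1) PN(2) L(3) S(1) P(2) L(2)] S by simp
      then show False using L S by simp
    qed
    then obtain U where U: "U \<in> ?B" "P \<subseteq> U"
      using between_through_point_exists[OF Ssub(1) vec.subspace_UNIV _ PN(1)] by blast
    have "N \<subseteq> U" using betweenD(2)[OF U(1)] S by blast
    then have "L \<subseteq> U"
      using pg_line_subset[OF PN(1) N(1) PN(2) L(3) P(2) L(2) betweenD(1)[OF U(1)] U(2)] by simp
    then show "L \<in> (\<Union>U\<in>?B. {L \<in> tangents. N \<subseteq> L \<and> L \<subseteq> U})" using U L by blast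
  qed
  then have "card {L \<in> tangents. N \<subseteq> L} \<le> card (\<Union>U\<in>?B. {L \<in> tangents. N \<subseteq> L \<and> L \<subseteq> U})"
    by (intro card_mono) auto
  also have "\<dots> \<le> (\<Sum>U\<in>?B. card {L \<in> tangents. N \<subseteq> L \<and> L \<subseteq> U})"
    by (intro card_UN_le) auto
  \<comment> \<open>Adding the cap points outside \<open>S\<close> on both sides replaces a
    subtraction inside the sum; each summand is then at most \<open>q\<close>.\<close>
  finally have "card {L \<in> tangents. N \<subseteq> L} + (\<Sum>U\<in>?B. npts K U - npts K S)
      \<le> (\<Sum>U\<in>?B. card {L \<in> tangents. N \<subseteq> L \<and> L \<subseteq> U} + (npts K U - npts K S))"
    by (simp add: sum.distrib)
  also have "\<dots> \<le> (\<Sum>U\<in>?B. q)"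
  proof (rule sum_mono)
    fix U assume U: "U \<in> ?B"
    have "card {L \<in> tangents. N \<subseteq> L \<and> L \<subseteq> U} + npts K U \<le> q + 2"
      using tangents_through_secant_point_plane[OF betweenD(1)[OF U] _ N S betweenD(2)[OF U]]
        betweenD(4)[OF U] Ssub(2) by simp
    moreover have "npts K S \<le> npts K U" using npts_mono betweenD(2)[OF U] by blast
    ultimately show "card {L \<in> tangents. N \<subseteq> L \<and> L \<subseteq> U} + (npts K U - npts K S) \<le> q"
      using S(2) by linarith
  qed
  also have "\<dots> = (q + 1) * q" using planes_through_line[OF S(1)] by simp
  also have "(\<Sum>U\<in>?B. npts K U - npts K S) = card K - 2"
    using sum_npts_between[of K S UNIV] K_points Ssub S(2) npts_UNIV by auto
  finally show ?thesis
    by (simp add: power2_eq_square algebra_simps)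
qed

text \<open>Double counting of the tangents at cap points other than \<open>P\<close> that are
  coplanar with \<open>l\<close>. The left side counts them plane by plane. Each of them meets
  \<open>l\<close> in one of its \<open>q\<close> points other than \<open>P\<close>, and by
  \<open>tangents_through_external_point\<close> such a point lies on at most as many tangents as
  \<open>P\<close>, one of which is \<open>l\<close>.\<close>

lemma tangent_planes_sum:
  assumes P: "P \<in> K" and l: "l \<in> tangents" "P \<subseteq> l"
  shows "(\<Sum>U\<in>between l UNIV. (npts K U - 1) * (q + 2 - npts K U)) \<le> q * (card {L \<in> tangents. P \<subseteq> L} - 1)"
proof -
  let ?B = "between l (UNIV :: ('a ^ 4) set)" and ?t = "card {L \<in> tangents. P \<subseteq> L}"
  have ll: "l \<in> pg_lines" using l by (simp add: tangents_def)
  note lsub = pg_linesD[OF ll]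
  define Z where "Z = (SIGMA U:?B. SIGMA P':{P' \<in> K - {P}. P' \<subseteq> U}. {L \<in> tangents. P' \<subseteq> L \<and> L \<subseteq> U})"
  define W where "W = (\<Union>Q\<in>{Q \<in> pg_points. Q \<subseteq> l} - {P}. {L \<in> tangents. Q \<subseteq> L} - {l})"
  have not_l: "\<not> P' \<subseteq> l" if "P' \<in> K" "P' \<noteq> P" for P'
    using tangent_point_unique[OF l(1) P l(2) that(1)] that(2) by blast
  have "card Z = (\<Sum>U\<in>?B. \<Sum>P'\<in>{P' \<in> K - {P}. P' \<subseteq> U}. card {L \<in> tangents. P' \<subseteq> L \<and> L \<subseteq> U})"
    unfolding Z_def by (simp add: card_SigmaI)
  also have "\<dots> = (\<Sum>U\<in>?B. (npts K U - 1) * (q + 2 - npts K U))"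
  proof (rule sum.cong[OF refl])
    fix U assume U: "U \<in> ?B"
    have dim: "vec.dim U = 3" using betweenD(4)[OF U] lsub by simp
    have PU: "P \<subseteq> U" using betweenD(2)[OF U] l by blast
    have "{P' \<in> K - {P}. P' \<subseteq> U} = {P' \<in> K. P' \<subseteq> U} - {P}" by blast
    then have "card {P' \<in> K - {P}. P' \<subseteq> U} = npts K U - 1"
      unfolding npts_def using P PU by simp
    moreover have "card {L \<in> tangents. P' \<subseteq> L \<and> L \<subseteq> U} = q + 2 - npts K U"
      if "P' \<in> {P' \<in> K - {P}. P' \<subseteq> U}" for P'
      using card_tangents_at_plane[of P' U] that betweenD(1)[OF U] dim by simp
    ultimately show "(\<Sum>P'\<in>{P' \<in> K - {P}. P' \<subseteq> U}. card {L \<in> tangents. P' \<subseteq> L \<and> L \<subseteq> U})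
        = (npts K U - 1) * (q + 2 - npts K U)" by simp
  qed
  finally have cardZ: "card Z = (\<Sum>U\<in>?B. (npts K U - 1) * (q + 2 - npts K U))" .
  have "card Z \<le> card W"
  proof (rule card_inj_on_le)
    \<comment> \<open>A tangent determines its contact point, and this point, being off
      \<open>l\<close>, determines the plane through \<open>l\<close>.\<close>
    show "inj_on (\<lambda>(U, P', L). L) Z"
    proof (rule inj_onI)
      fix z z' assume z: "z \<in> Z" "z' \<in> Z" "(\<lambda>(U, P', L). L) z = (\<lambda>(U, P', L). L) z'"
      obtain U1 P1 L1 U2 P2 L2 where zz: "z = (U1, P1, L1)" "z' = (U2, P2, L2)" by (metis prod_cases3)
      have "L2 = L1" using z(3) zz by simp
      then have "(U1, P1, L1) \<in> Z" "(U2, P2, L1) \<in> Z" using z zz by simp_all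
      then have 1: "U1 \<in> ?B" "P1 \<in> K" "P1 \<noteq> P" "P1 \<subseteq> U1" "L1 \<in> tangents" "P1 \<subseteq> L1"
        and 2: "U2 \<in> ?B" "P2 \<in> K" "P2 \<subseteq> U2" "P2 \<subseteq> L1" unfolding Z_def by auto
      have "P1 = P2" using tangent_point_unique 1 2 by blast
      moreover have "U1 = U2"
        using between_through_point_unique[OF lsub(1) K_points[OF 1(2)] 1(1) 2(1) 1(4)] 2(3) calculation not_l[OF 1(2,3)]
        by simp
      ultimately show "z = z'" using zz \<open>L2 = L1\<close> by simp
    qed
    show "(\<lambda>(U, P', L). L) ` Z \<subseteq> W"
    proof (rule image_subsetI)
      fix z assume z: "z \<in> Z"
      obtain U P' L where zz: "z = (U, P', L)" by (metis prod_cases3)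
      have 1: "U \<in> ?B" "P' \<in> K" "P' \<noteq> P" "P' \<subseteq> U" "L \<in> tangents" "P' \<subseteq> L" "L \<subseteq> U"
        using z unfolding zz Z_def by auto
      have "L \<in> pg_lines" using 1 by (simp add: tangents_def)
      then obtain Q where Q: "Q \<in> pg_points" "Q \<subseteq> L" "Q \<subseteq> l"
        using coplanar_lines_meet[of L l U] ll betweenD[OF 1(1)] lsub 1 by auto
      have "L \<noteq> l" using not_l 1 by blast
      moreover have "Q \<noteq> P" using tangent_point_unique[OF 1(5,2,6) P] Q 1(3) by blast
      ultimately have "L \<in> W" unfolding W_def using Q 1 by blast
      then show "(\<lambda>(U, P', L). L) z \<in> W" using zz by simp
    qed
  qed simp
  also have "card W \<le> (\<Sum>Q\<in>{Q \<in> pg_points. Q \<subseteq> l} - {P}. card ({L \<in> tangents. Q \<subseteq> L} - {l}))"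
    unfolding W_def by (intro card_UN_le) auto
  also have "\<dots> \<le> (\<Sum>Q\<in>{Q \<in> pg_points. Q \<subseteq> l} - {P}. ?t - 1)"
  proof (rule sum_mono)
    fix Q assume "Q \<in> {Q \<in> pg_points. Q \<subseteq> l} - {P}"
    then have Q: "Q \<in> pg_points" "Q \<subseteq> l" "Q \<noteq> P" by auto
    then have "Q \<notin> K" using not_l by blast
    then have "card {L \<in> tangents. Q \<subseteq> L} \<le> ?t"
      using tangents_through_external_point[OF Q(1)] card_tangents_at_space[OF P] by simp
    then show "card ({L \<in> tangents. Q \<subseteq> L} - {l}) \<le> ?t - 1" using l Q by simp
  qed
  also have "\<dots> = q * (?t - 1)"
    using card_pg_points_in_line[OF ll] card_field K_points[OF P] l(2) by simp
  finally show ?thesis using cardZ by simp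
qed

text \<open>Two distinct tangents at \<open>P\<close> span exactly one plane.\<close>

lemma tangent_linear_space:
  assumes P: "P \<in> K"
  shows "linear_space {L \<in> tangents. P \<subseteq> L} {U. vec.subspace U \<and> vec.dim U = 3 \<and> P \<subseteq> U}
    (\<lambda>U. {L \<in> tangents. P \<subseteq> L \<and> L \<subseteq> U})"
proof -
  note PP = K_points[OF P]
  have btw: "U \<in> between L UNIV" if "L \<in> tangents" "vec.subspace U" "vec.dim U = 3" "L \<subseteq> U" for L U
    using that pg_linesD[of L] by (auto simp: between_def tangents_def)
  have other: "\<exists>x. x \<in> M \<and> x \<notin> L" if "L \<in> tangents" "M \<in> tangents" "L \<noteq> M" for L M
  proof (rule ccontr)
    assume "\<not> ?thesis"
    then have "M \<subseteq> L" by blast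
    then show False using that vec.subspace_dim_equal[of M L] by (auto simp: tangents_def pg_lines_def)
  qed
  show ?thesis
  proof
    fix L M assume L: "L \<in> {L \<in> tangents. P \<subseteq> L}" and M: "M \<in> {L \<in> tangents. P \<subseteq> L}" and "L \<noteq> M"
    then obtain x where x: "x \<in> M" "x \<notin> L" using other[of L M] by blast
    have lines: "L \<in> pg_lines" "M \<in> pg_lines" using L M by (auto simp: tangents_def)
    let ?U = "vec.span (insert x L)"
    have U: "?U \<in> between L UNIV"
      using span_insert_between[of L UNIV x] pg_linesD(1)[OF lines(1)] x by simp
    have "M \<in> between P UNIV" using pg_line_between_iff[OF PP] M lines by simp
    then have "M = vec.span (insert x P)"
      using between_eq_span_insert[OF pg_pointD(1)[OF PP] _ x(1)] x(2) L by blast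
    also have "\<dots> \<subseteq> ?U" using L by (intro vec.span_mono) auto
    finally have "M \<subseteq> ?U" .
    moreover have "vec.subspace ?U" "vec.dim ?U = 3" "L \<subseteq> ?U" "P \<subseteq> ?U"
      using betweenD[OF U] pg_linesD[OF lines(1)] L by auto
    ultimately show "\<exists>U\<in>{U. vec.subspace U \<and> vec.dim U = 3 \<and> P \<subseteq> U}.
        L \<in> {L \<in> tangents. P \<subseteq> L \<and> L \<subseteq> U} \<and> M \<in> {L \<in> tangents. P \<subseteq> L \<and> L \<subseteq> U}"
      using L M by blast
  next
    fix U U' L M
    assume U: "U \<in> {U. vec.subspace U \<and> vec.dim U = 3 \<and> P \<subseteq> U}" "U' \<in> {U. vec.subspace U \<and> vec.dim U = 3 \<and> P \<subseteq> U}"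
      and L: "L \<in> {L \<in> tangents. P \<subseteq> L \<and> L \<subseteq> U}" "L \<in> {L \<in> tangents. P \<subseteq> L \<and> L \<subseteq> U'}"
      and M: "M \<in> {L \<in> tangents. P \<subseteq> L \<and> L \<subseteq> U}" "M \<in> {L \<in> tangents. P \<subseteq> L \<and> L \<subseteq> U'}" and "L \<noteq> M"
    then obtain x where x: "x \<in> M" "x \<notin> L" using other[of L M] by blast
    have "U \<in> between L UNIV" "U' \<in> between L UNIV" using btw L U by auto
    moreover have "vec.subspace L" using L pg_linesD by (auto simp: tangents_def)
    ultimately show "U = U'" using between_unique[of L U UNIV U' UNIV x] x M by blast
  qed auto
qed

text \<open>As \<open>card K = q ^ 2 + q + 2 - t\<close>, the case \<open>t = q + 1\<close> gives
  the second alternative and \<open>t \<ge> 2 * q - 1\<close> the first. Every other value of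
  \<open>t\<close> has to be excluded.\<close>

lemma card_cases: "card K \<le> q ^ 2 - q + 3 \<or> card K = q ^ 2 + 1"
proof -
  obtain P where P: "P \<in> K" using nonempty by blast
  define T where "T = {L \<in> tangents. P \<subseteq> L}"
  define t where "t = card T"
  define planes where "planes = {U :: ('a ^ 4) set. vec.subspace U \<and> vec.dim U = 3 \<and> P \<subseteq> U}"
  define inc where "inc U = {L \<in> tangents. P \<subseteq> L \<and> L \<subseteq> U}" for U
  interpret ls: linear_space T planes inc
    using tangent_linear_space[OF P] unfolding T_def planes_def inc_def[abs_def] .
  have tk: "t + card K = q ^ 2 + q + 2" using card_tangents_at_space[OF P] by (simp add: t_def T_def)
  have plane: "card (inc U) + npts K U = q + 2" "1 \<le> npts K U" if "U \<in> planes" for U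
  proof -
    show "card (inc U) + npts K U = q + 2"
      using card_tangents_at_plane[OF P] that by (simp add: planes_def inc_def)
    show "1 \<le> npts K U"
      using npts_mono[of P U] npts_point[OF P] that by (simp add: planes_def)
  qed
  have star: "{U \<in> planes. l \<in> inc U} = between l UNIV" if "l \<in> T" for l
    using that pg_linesD[of l] by (auto simp: planes_def inc_def T_def tangents_def between_def)
  have squares: "q ^ 2 + q + 1 \<le> (\<Sum>U\<in>{U \<in> planes. l \<in> inc U}. (card (inc U) - 1) ^ 2) + card T"
    if l: "l \<in> T" for l
  proof -
    let ?B = "{U \<in> planes. l \<in> inc U}"
    have pos: "1 \<le> card (inc U)" if "U \<in> ?B" for U
      using that ls.finite_inc by (auto simp: Suc_le_eq card_gt_0_iff)
    have tpos: "1 \<le> t" using l ls.fin by (auto simp: t_def Suc_le_eq card_gt_0_iff)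
    have cardB: "card ?B = q + 1"
      using planes_through_line[of l] star[OF l] l by (simp add: T_def tangents_def)
    \<comment> \<open>With \<open>a + 1\<close> tangents at \<open>P\<close> and
      \<open>b + 1\<close> cap points in a plane through \<open>P\<close>, \<open>q = a + b\<close>,
      and the identity is \<open>b * (a + 1) + a ^ 2 = (q - 1) * a + q\<close>.\<close>
    have "(\<Sum>U\<in>?B. (npts K U - 1) * (q + 2 - npts K U)) + (\<Sum>U\<in>?B. (card (inc U) - 1) ^ 2)
        = (\<Sum>U\<in>?B. (q - 1) * (card (inc U) - 1) + q)"
      unfolding sum.distrib[symmetric]
    proof (rule sum.cong[OF refl])
      fix U assume U: "U \<in> ?B"
      obtain a where a: "card (inc U) = Suc a" using pos[OF U] by (metis Suc_le_D One_nat_def)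
      obtain b where b: "npts K U = Suc b" using plane(2) U by (metis Suc_le_D One_nat_def mem_Collect_eq)
      have q: "q = a + b" using plane(1)[of U] U a b by simp
      show "(npts K U - 1) * (q + 2 - npts K U) + (card (inc U) - 1) ^ 2 = (q - 1) * (card (inc U) - 1) + q"
      proof (cases a)
        case 0
        then show ?thesis using a b q by simp
      next
        case (Suc c)
        then show ?thesis using a b q by (simp add: power2_eq_square algebra_simps)
      qed
    qed
    also have "\<dots> = (q - 1) * (t - 1) + (q + 1) * q"
      using ls.sum_card_inc[OF l] cardB by (simp add: sum.distrib flip: sum_distrib_left t_def)
    finally have "(q - 1) * (t - 1) + (q + 1) * q \<le> q * (t - 1) + (\<Sum>U\<in>?B. (card (inc U) - 1) ^ 2)"
      using tangent_planes_sum[OF P, of l] l star[OF l] by (simp add: T_def t_def)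
    moreover have "q * (t - 1) = (q - 1) * (t - 1) + (t - 1)"
      using q_ge_4 by (cases q) simp_all
    ultimately have "(q + 1) * q + 1 \<le> (\<Sum>U\<in>?B. (card (inc U) - 1) ^ 2) + t"
      using tpos by linarith
    then show ?thesis by (simp add: t_def power2_eq_square)
  qed
  have t0: "t \<noteq> 0"
  proof
    assume "t = 0"
    then have k: "card K = q ^ 2 + q + 2" using tk by simp
    \<comment> \<open>The number of tangents is the same at every point of \<open>K\<close>.\<close>
    have no_tangent: "tangents = {}"
    proof (rule ccontr)
      assume "tangents \<noteq> {}"
      then obtain L where L: "L \<in> tangents" by blast
      then obtain P' where P': "P' \<in> K" "P' \<subseteq> L" using tangent_point by blast
      have "card {L \<in> tangents. P' \<subseteq> L} = 0" using card_tangents_at_space[OF P'(1)] k by simp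
      then have "{L \<in> tangents. P' \<subseteq> L} = {}" by simp
      then show False using L P' by blast
    qed
    have PP: "P \<in> pg_points" by (rule K_points[OF P])
    have "card (between P (UNIV :: ('a ^ 4) set)) \<noteq> 0"
      using card_tangents_at[OF P vec.subspace_UNIV subset_UNIV] npts_UNIV k by linarith
    then obtain L where "L \<in> between P UNIV" by fastforce
    then have L: "L \<in> pg_lines" using pg_line_between_iff[OF PP] by blast
    \<comment> \<open>A line has \<open>q + 1\<close> points and at most two of them are in
      \<open>K\<close>, so there is a point \<open>Q\<close> outside \<open>K\<close>.\<close>
    have "\<not> {Q \<in> pg_points. Q \<subseteq> L} \<subseteq> {Q \<in> K. Q \<subseteq> L}"
    proof
      assume "{Q \<in> pg_points. Q \<subseteq> L} \<subseteq> {Q \<in> K. Q \<subseteq> L}"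
      then have "card {Q \<in> pg_points. Q \<subseteq> L} \<le> npts K L"
        unfolding npts_def by (rule card_mono[rotated]) simp
      then show False using card_pg_points_in_line[OF L] npts_line_le_2[OF L] card_field q_ge_4 by simp
    qed
    then obtain Q where Q: "Q \<in> pg_points" "Q \<notin> K" by blast
    have "\<not> (\<exists>R\<in>K. R \<subseteq> Q)" using pg_point_subset_eq K_points Q by blast
    then have nQ: "npts K Q = 0" using npts_pos_iff[of Q] by simp
    have sumQ: "(\<Sum>L\<in>between Q UNIV. npts K L) = card K"
      using sum_npts_between[of K Q UNIV] K_points pg_pointD(1)[OF Q(1)] nQ npts_UNIV by auto
    have cardQ: "card (between Q (UNIV :: ('a ^ 4) set)) = q ^ 2 + q + 1"
      using card_between_3[of Q UNIV] pg_pointD[OF Q(1)] card_field by (simp add: card_cart_basis)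
    \<comment> \<open>In the absence of tangents, \<open>q ^ 2 + q + 1\<close> lines through
      \<open>Q\<close> all meeting \<open>K\<close> would carry two cap points each, which exceeds
      \<open>card K\<close>.\<close>
    have "\<exists>L\<in>between Q UNIV. npts K L = 0"
    proof (rule ccontr)
      assume nz: "\<not> ?thesis"
      have "2 \<le> npts K L" if "L \<in> between Q UNIV" for L
      proof -
        have "npts K L \<noteq> 1" "npts K L \<noteq> 0"
          using that nz no_tangent pg_line_between_iff[OF Q(1)] by (auto simp: tangents_def)
        then show ?thesis by linarith
      qed
      then have "(\<Sum>L\<in>between Q (UNIV :: ('a ^ 4) set). 2) \<le> card K"
        unfolding sumQ[symmetric] by (rule sum_mono)
      then show False using cardQ k q_ge_4 by simp
    qed
    then obtain l where l: "l \<in> pg_lines" "npts K l = 0" using pg_line_between_iff[OF Q(1)] by blast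
    have "(\<Sum>U\<in>between l UNIV. npts K U) = card K"
      using sum_npts_between[of K l UNIV] K_points pg_linesD(1)[OF l(1)] l(2) npts_UNIV by auto
    \<comment> \<open>A plane without tangents that meets \<open>K\<close> has exactly
      \<open>q + 2\<close> cap points.\<close>
    moreover have "q + 2 dvd npts K U" if U: "U \<in> between l UNIV" for U
    proof (cases "npts K U = 0")
      case False
      then obtain R where R: "R \<in> K" "R \<subseteq> U" using npts_pos_iff[of U] by auto
      then have "npts K U = q + 2"
        using card_tangents_at_plane[OF R(1) betweenD(1)[OF U] R(2)] betweenD(4)[OF U] pg_linesD(2)[OF l(1)]
          no_tangent by simp
      then show ?thesis by simp
    qed simp
    ultimately have "q + 2 dvd q ^ 2 + q + 2" using k by (metis dvd_sum)
    \<comment> \<open>Adding \<open>q + 2\<close> shows that the remainder modulo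
      \<open>q + 2\<close> is that of 4.\<close>
    then have "q + 2 dvd (q + 2) + (q ^ 2 + q + 2)" by (rule dvd_add[OF dvd_refl])
    also have "(q + 2) + (q ^ 2 + q + 2) = (q + 2) * q + 4" by (simp add: power2_eq_square algebra_simps)
    finally have "q + 2 dvd 4" by (metis dvd_add_right_iff dvd_triv_left)
    then show False using q_ge_4 by (auto dest: dvd_imp_le)
  qed
  \<comment> \<open>For \<open>t \<le> q\<close>, the numbers \<open>card (inc U) - 1\<close> have
    sum \<open>t - 1\<close>, so their squares sum to at most \<open>(t - 1) ^ 2\<close>; then
    \<open>squares\<close> fails.\<close>
  have "q < t"
  proof (rule ccontr)
    assume tq: "\<not> q < t"
    obtain l where l: "l \<in> T" using t0 by (auto simp: t_def)
    let ?B = "{U \<in> planes. l \<in> inc U}"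
    have "card (inc U) - 1 \<le> t - 1" if "U \<in> ?B" for U
      using card_mono[OF ls.fin(1) ls.inc_sub, of U] that by (auto simp: t_def)
    then have "(\<Sum>U\<in>?B. (card (inc U) - 1) ^ 2) \<le> (\<Sum>U\<in>?B. (t - 1) * (card (inc U) - 1))"
      unfolding power2_eq_square by (intro sum_mono mult_right_mono) auto
    also have "\<dots> = (t - 1) * (t - 1)"
      using ls.sum_card_inc[OF l] by (simp add: t_def flip: sum_distrib_left)
    also have "\<dots> \<le> q * q" using tq by (intro mult_mono) auto
    finally show False using squares[OF l] tq by (simp add: power2_eq_square t_def)
  qed
  show ?thesis
  proof (cases "t = q + 1")
    case True
    then show ?thesis using tk by simp
  next
    case False
    then have "q + 1 < card T" using \<open>q < t\<close> by (simp add: t_def)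
    moreover have "card (inc U) \<le> q + 1" if "U \<in> planes" for U using plane[OF that] by linarith
    ultimately have "2 * q \<le> t + 1"
      using ls.card_points_ge[OF even_q q_ge_4] squares by (simp add: t_def)
    moreover have "q \<le> q ^ 2" by (simp add: power2_eq_square)
    ultimately show ?thesis using tk by linarith
  qed
qed

end

text \<open>The empty cap satisfies the bound trivially. For any other one, maximality provides the
  secants required by \<open>complete_even_cap\<close>.\<close>

lemma card_complete_cap:
  fixes K :: "('a::{field,finite} ^ 4) set set"
  assumes "even CARD('a)" "CARD('a) \<ge> 4" "complete_cap k K"
  shows "k \<le> CARD('a) ^ 2 - CARD('a) + 3 \<or> k = CARD('a) ^ 2 + 1"
proof (cases "K = {}")
  case True
  then show ?thesis using assms(3) by (simp add: complete_cap_def cap_def)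
next
  case False
  have cap: "cap k K" and max: "\<And>K'. K \<subseteq> K' \<Longrightarrow> \<not> cap (k + 1) K'"
    using assms(3) unfolding complete_cap_def by blast+
  have k: "card K = k" using cap by (simp add: cap_def)
  interpret even_cap K "CARD('a)"
    using assms(1) cap k by unfold_locales auto
  interpret complete_even_cap K "CARD('a)"
  proof
    fix N assume N: "N \<in> pg_points" "N \<notin> K"
    have "\<not> cap (k + 1) (insert N K)" by (rule max) auto
    moreover have "insert N K \<subseteq> pg_points" "card (insert N K) = k + 1"
      using N k K_points by auto
    ultimately obtain P Q R where PQR: "P \<in> insert N K" "Q \<in> insert N K" "R \<in> insert N K"
      "P \<noteq> Q" "P \<noteq> R" "Q \<noteq> R" "pg_collinear {P, Q, R}"
      unfolding cap_def by blast
    obtain L where L: "L \<in> pg_lines" "P \<subseteq> L" "Q \<subseteq> L" "R \<subseteq> L"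
      using PQR(7) unfolding pg_collinear_def by blast
    \<comment> \<open>The collinear triple must contain \<open>N\<close>, and its other two points
      make the line a secant.\<close>
    have "\<not> (P \<in> K \<and> Q \<in> K \<and> R \<in> K)"
      using K_no_three_collinear[of P Q R L] PQR L by blast
    then obtain A B where AB: "A \<in> K" "B \<in> K" "A \<noteq> B" "A \<subseteq> L" "B \<subseteq> L" and "N \<subseteq> L"
      using PQR L by blast
    have "card {A, B} \<le> npts K L"
      unfolding npts_def by (rule card_mono) (use AB in auto)
    then have "npts K L = 2" using npts_line_le_2[OF L(1)] AB(3) by simp
    then show "\<exists>S\<in>pg_lines. npts K S = 2 \<and> N \<subseteq> S" using L(1) \<open>N \<subseteq> L\<close> by blast
  qed (use assms False in auto)
  show ?thesis using card_cases k by simp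
qed

theorem theorem2p1:
  fixes q :: nat
  assumes "CARD('a::{field,finite}) = q" and "even q" and "q \<ge> 8"
  shows "m2' TYPE('a ^ 4) \<le> q ^ 2 - q + 3"
proof -
  let ?Z = "complete_cap_sizes TYPE('a ^ 4)"
  have dichotomy: "k \<le> q ^ 2 - q + 3 \<or> k = q ^ 2 + 1" if k: "k \<in> ?Z" for k
  proof -
    obtain K :: "('a ^ 4) set set" where "complete_cap k K"
      using k unfolding complete_cap_sizes_def by blast
    then show ?thesis using card_complete_cap[of k K] assms by simp
  qed
  have fin: "finite ?Z" by (rule finite_complete_cap_sizes)
  \<comment> \<open>A size above the bound is \<open>q ^ 2 + 1\<close>. The largest size, being no
    smaller, then has the same value, so \<open>k\<close> is the size that was removed.\<close>
  have bound: "k \<le> q ^ 2 - q + 3" if k: "k \<in> ?Z - {Sup ?Z}" for k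
  proof (rule ccontr)
    assume big: "\<not> k \<le> q ^ 2 - q + 3"
    have Sup: "Sup ?Z = Max ?Z" using fin k by (intro cSup_eq_Max) auto
    have "Max ?Z \<in> ?Z" using k by (intro Max_in fin) auto
    moreover have "k \<le> Max ?Z" using k by (intro Max_ge fin) auto
    ultimately show False using dichotomy[of k] dichotomy[of "Max ?Z"] k big Sup by auto
  qed
  show ?thesis
  proof (cases "?Z - {Sup ?Z} = {}")
    \<comment> \<open>If no second size occurs, the supremum of the empty set of natural numbers is
      0.\<close>
    case True
    show ?thesis unfolding m2'_def True by (simp add: Sup_nat_def)
  next
    case False
    then show ?thesis unfolding m2'_def using bound by (intro cSup_least) auto
  qed
qed

end
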